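(* Let $a\colon\mathbb{N}\to\mathbb{C}$ be a bounded sequence such that $$\sum_{n\leq x} a(pn)\overline{a(qn)} = o(x)\quad (x\to\infty)\qquad\text{for all distinct primes $p$ and $q$.}$$ If $E\subset\mathbb{N}$ belongs to one of the classes $\mathcal{D}^{(\infty)}$, $\mathcal{E}_{\mathrm{c.pt.}}$ or $\mathcal{E}_{\mathrm{pol}}$, then $$\sum_{n\leq x} \mathbf{1}_{E}(n)\,a(n)=o(x)\quad (x\to\infty).$$
   Context: $\mathbb{N}=\{1,2,\ldots\}$; $\mathbf{1}_E$ is the indicator function of $E$. A function $f\colon\mathbb{N}\to\mathbb{C}$ is multiplicative if $f(1)=1$ and $f(mn)=f(m)f(n)$ whenever $\gcd(m,n)=1$. For $r\in\mathbb{N}$, $\mathcal{D}^{(r)}$ is the collection of all sets of the form $\{n\in\mathbb{N}: f_1(n)=z_1,\ldots,f_r(n)=z_r\}$, where $f_1,\ldots,f_r\colon\mathbb{N}\to\mathbb{C}$ are arbitrary multiplicative functions and $z_1,\ldots,z_r$ are arbitrary complex numbers; $\mathcal{D}^{(\infty)}:=\bigcup_{r\geq 1}\mathcal{D}^{(r)}$. A point $z\in\mathbb{C}$ is a concentration point for $f\colon\mathbb{N}\to\mathbb{C}$ if $\sum_{p\text{ prime},\,f(p)=z}\frac1p=\infty$. $\mathcal{E}_{\mathrm{c.pt.}}$ is the collection of all sets of the form $\{n\in\mathbb{N}:f(n)\in K\}$, where $K\subset\mathbb{C}$ is arbitrary and $f\colon\mathbb{N}\to\mathbb{C}$ is a multiplicative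 function possessing at least one concentration point. A set $K\subset\mathbb{C}$ is an elementary set in polar coordinates if it is a finite union of sets of the form $\{re^{2\pi i\varphi}: r\in I_1,\varphi\in I_2\}$, where $I_1,I_2$ are (open, closed or half-open) intervals in $\mathbb{R}$. $\mathcal{E}_{\mathrm{pol}}$ is the collection of all sets of the form $\{n\in\mathbb{N}:f(n)\in K\}$, where $K$ is an elementary set in polar coordinates and $f$ is a multiplicative function bounded in modulus by $1$ with $\lim_{N\to\infty}\frac1N\sum_{n=1}^N|f(n)|\neq 0$ (this limit always exists, by Wirsing's theorem). *)

theory Defs
  imports "HOL-Analysis.Analysis" "HOL-Computational_Algebra.Primes" "HOL-Library.Landau_Symbols"
begin

text \<open>
  Arithmetic functions on the positive integers are modelled as functions on \<^typ>\<open>nat\<close>; every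
  condition below is restricted to positive arguments, so their values at \<open>0\<close> are irrelevant.
\<close>

definition multiplicative_fun :: "(nat \<Rightarrow> complex) \<Rightarrow> bool" where
  "multiplicative_fun f \<longleftrightarrow>
     f 1 = 1 \<and> (\<forall>m>0. \<forall>n>0. coprime m n \<longrightarrow> f (m * n) = f m * f n)"

definition D_class :: "nat \<Rightarrow> nat set set" where
  "D_class r =
     {{n. n > 0 \<and> (\<forall>i\<in>{1..r}. f i n = z i)} | f z. \<forall>i\<in>{1..r}. multiplicative_fun (f i)}"

definition D_inf :: "nat set set" where
  "D_inf = (\<Union>r\<in>{1..}. D_class r)"

text \<open>The terms \<open>1 / p\<close> being nonnegative, divergence of the sum to infinity is non-summability.\<close>

definition concentration_point :: "(nat \<Rightarrow> complex) \<Rightarrow> complex \<Rightarrow> bool" where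
  "concentration_point f z \<longleftrightarrow> \<not> (\<lambda>p. 1 / real p) summable_on {p. prime p \<and> f p = z}"

definition E_cpt :: "nat set set" where
  "E_cpt =
     {{n. n > 0 \<and> f n \<in> K} | f K. multiplicative_fun f \<and> (\<exists>z. concentration_point f z)}"

definition polar_box :: "real set \<Rightarrow> real set \<Rightarrow> complex set" where
  "polar_box I1 I2 =
     {of_real r * exp (2 * of_real pi * \<i> * of_real \<phi>) | r \<phi>. r \<in> I1 \<and> \<phi> \<in> I2}"

text \<open>
  As \<^const>\<open>is_interval\<close> is used, intervals may be degenerate or unbounded, and the radial interval
  may contain negative numbers.
\<close>

definition elementary_polar :: "complex set \<Rightarrow> bool" where
  "elementary_polar K \<longleftrightarrow>
     (\<exists>F. finite F \<and> (\<forall>(I1, I2)\<in>F. is_interval I1 \<and> is_interval I2) \<and>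
          K = (\<Union>(I1, I2)\<in>F. polar_box I1 I2))"

text \<open>In \<open>E_pol\<close> the mean value of \<open>\<bar>f\<bar>\<close> is required to exist and to be nonzero.\<close>

definition E_pol :: "nat set set" where
  "E_pol =
     {{n. n > 0 \<and> f n \<in> K} | f K.
        elementary_polar K \<and> multiplicative_fun f \<and> (\<forall>n>0. cmod (f n) \<le> 1) \<and>
        (\<exists>L. L \<noteq> 0 \<and> (\<lambda>N. (\<Sum>n=1..N. cmod (f n)) / real N) \<longlonglongrightarrow> L)}"

end

theory Submission
  imports Defs "HOL-Computational_Algebra.Squarefree"
begin

text \<open>
  The proof combines the orthogonality method of Daboussi and Katai with a compactness argument.

  Let \<open>Q\<close> be a finite set of primes and \<open>A\<close> the sum of \<open>1 / p\<close> over \<open>p \<in> Q\<close>. By the Turan--Kubilius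
  inequality most \<open>n\<close> have about \<open>A\<close> prime divisors in \<open>Q\<close>, so \<open>A\<close> times the sum of \<open>1\<^sub>E(n) a(n)\<close> over
  \<open>n \<le> x\<close> is close to the sum of \<open>1\<^sub>E(p m) a(p m)\<close> over all \<open>p \<in> Q\<close> and \<open>m \<le> x / p\<close>
  (\<open>Turan_Kubilius_weighted\<close>). The hypothesis on \<open>a\<close> says that the sequences \<open>\<lambda>m. a (p * m)\<close> are
  asymptotically orthogonal for distinct \<open>p\<close>. If the dilated sets \<open>{m. p * m \<in> E}\<close> were the same for
  all \<open>p \<in> Q\<close>, the Cauchy--Schwarz inequality in \<open>m\<close> would make the double sum much smaller than
  \<open>A * x\<close>, and dividing by the large number \<open>A\<close> would finish the proof.

  In general the dilated sets vary with \<open>p\<close>, but it suffices that they form a totally bounded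
  family with respect to the density of symmetric differences on \<open>{1..y}\<close>, with covering numbers
  that do not depend on \<open>y\<close>: then \<open>p\<close> may be sorted into boundedly many classes within which the sets
  nearly agree, and the number of classes is fixed before \<open>A\<close> is chosen
  (\<open>dilates_bound\<close>, \<open>orthogonality_criterion\<close>).

  For the three classes of sets this holds for the following reasons. For \<open>p\<close> coprime to \<open>m\<close>, the
  condition \<open>f (p * m) \<in> K\<close> reads \<open>f p * f m \<in> K\<close>. If \<open>f\<close> has a concentration point \<open>z\<close>, take only
  primes with \<open>f p = z\<close>; their reciprocals have divergent sum and the condition does not involve \<open>p\<close>.
  If \<open>K\<close> is elementary in polar coordinates, take all primes: the condition is a Boolean combination
  of inequalities for the product of the moduli and for the sum of the angles of \<open>f p\<close> and \<open>f m\<close>, and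
  each of these inequalities defines sets of \<open>m\<close> that are nested as \<open>p\<close> varies. Nested subsets of \<open>{1..y}\<close> are close as soon as their
  cardinalities are, so every chain has covering numbers of order \<open>1 / \<epsilon>\<close>
  (\<open>uniformly_totally_bounded_chain\<close>, \<open>uniformly_totally_bounded_elementary_polar\<close>). Finally, a single
  point is an elementary set, and total boundedness passes to finite intersections; this settles
  \<open>D_inf\<close>.
\<close>

section \<open>Uniformly totally bounded families of sets\<close>

text \<open>
  For fixed \<open>y > 0\<close>, the number of \<open>m \<le> y\<close> on which \<open>\<Phi> p\<close> and \<open>\<Phi> q\<close> differ, divided by \<open>y\<close>, is a
  pseudometric on \<open>P\<close>. The definition says that the covering numbers of these pseudometrics at each
  scale \<open>\<epsilon>\<close> admit a bound independent of \<open>y\<close>. The cover is encoded as a colouring \<open>c\<close> of \<open>P\<close> with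
  \<open>C\<close> colours, because colourings of two families combine to a colouring by pairs.
\<close>

definition uniformly_totally_bounded :: "nat set \<Rightarrow> (nat \<Rightarrow> nat \<Rightarrow> bool) \<Rightarrow> bool" where
  "uniformly_totally_bounded P \<Phi> \<longleftrightarrow>
     (\<forall>\<epsilon>>0. \<exists>C. \<forall>y. \<exists>c::nat \<Rightarrow> nat. (\<forall>p\<in>P. c p < C) \<and>
        (\<forall>p\<in>P. \<forall>q\<in>P. c p = c q \<longrightarrow>
            real (card {m \<in> {1..y}. \<Phi> p m \<noteq> \<Phi> q m}) \<le> \<epsilon> * real y))"

lemma uniformly_totally_bounded_fixed_set:
  "uniformly_totally_bounded P (\<lambda>p m. R m)"
  unfolding uniformly_totally_bounded_def
  by (intro allI impI exI[of _ 1] exI[of _ "\<lambda>_. 0"]) auto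

lemma uniformly_totally_bounded_all_or_nothing:
  "uniformly_totally_bounded P (\<lambda>p m. R p)"
  unfolding uniformly_totally_bounded_def
proof (intro allI impI exI[of _ 2] exI[of _ "\<lambda>p. of_bool (R p)"] conjI ballI)
  fix \<epsilon> :: real and y p q :: nat
  assume "\<epsilon> > 0" and "(of_bool (R p) :: nat) = of_bool (R q)"
  then have "{m \<in> {1..y}. R p \<noteq> R q} = {}"
    by (cases "R p"; cases "R q") auto
  then show "real (card {m \<in> {1..y}. R p \<noteq> R q}) \<le> \<epsilon> * real y"
    using \<open>\<epsilon> > 0\<close> by (simp only: card.empty) simp
qed auto

lemma uniformly_totally_bounded_not:
  "uniformly_totally_bounded P \<Phi> \<Longrightarrow> uniformly_totally_bounded P (\<lambda>p m. \<not> \<Phi> p m)"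
  unfolding uniformly_totally_bounded_def by simp

text \<open>
  The product of the two colourings works, since the two exceptional sets add up.
\<close>

lemma uniformly_totally_bounded_conj:
  assumes "uniformly_totally_bounded P \<Phi>" and "uniformly_totally_bounded P \<Psi>"
  shows "uniformly_totally_bounded P (\<lambda>p m. \<Phi> p m \<and> \<Psi> p m)"
  unfolding uniformly_totally_bounded_def
proof (intro allI impI)
  fix \<epsilon> :: real assume "\<epsilon> > 0"
  then have "\<epsilon> / 2 > 0" by simp
  obtain C where C: "\<And>y. \<exists>c::nat \<Rightarrow> nat. (\<forall>p\<in>P. c p < C) \<and> (\<forall>p\<in>P. \<forall>q\<in>P. c p = c q \<longrightarrow>
      real (card {m \<in> {1..y}. \<Phi> p m \<noteq> \<Phi> q m}) \<le> \<epsilon> / 2 * real y)"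
    using assms(1) \<open>\<epsilon> / 2 > 0\<close> unfolding uniformly_totally_bounded_def by blast
  obtain D where D: "\<And>y. \<exists>d::nat \<Rightarrow> nat. (\<forall>p\<in>P. d p < D) \<and> (\<forall>p\<in>P. \<forall>q\<in>P. d p = d q \<longrightarrow>
      real (card {m \<in> {1..y}. \<Psi> p m \<noteq> \<Psi> q m}) \<le> \<epsilon> / 2 * real y)"
    using assms(2) \<open>\<epsilon> / 2 > 0\<close> unfolding uniformly_totally_bounded_def by blast
  show "\<exists>C. \<forall>y. \<exists>c::nat \<Rightarrow> nat. (\<forall>p\<in>P. c p < C) \<and> (\<forall>p\<in>P. \<forall>q\<in>P. c p = c q \<longrightarrow>
     real (card {m \<in> {1..y}. (\<Phi> p m \<and> \<Psi> p m) \<noteq> (\<Phi> q m \<and> \<Psi> q m)}) \<le> \<epsilon> * real y)"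
  proof (intro exI[of _ "C * D"] allI)
    fix y
    obtain c :: "nat \<Rightarrow> nat" where c: "\<forall>p\<in>P. c p < C" "\<forall>p\<in>P. \<forall>q\<in>P. c p = c q \<longrightarrow>
        real (card {m \<in> {1..y}. \<Phi> p m \<noteq> \<Phi> q m}) \<le> \<epsilon> / 2 * real y" using C[of y] by blast
    obtain d :: "nat \<Rightarrow> nat" where d: "\<forall>p\<in>P. d p < D" "\<forall>p\<in>P. \<forall>q\<in>P. d p = d q \<longrightarrow>
        real (card {m \<in> {1..y}. \<Psi> p m \<noteq> \<Psi> q m}) \<le> \<epsilon> / 2 * real y" using D[of y] by blast
    show "\<exists>c::nat \<Rightarrow> nat. (\<forall>p\<in>P. c p < C * D) \<and> (\<forall>p\<in>P. \<forall>q\<in>P. c p = c q \<longrightarrow>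
       real (card {m \<in> {1..y}. (\<Phi> p m \<and> \<Psi> p m) \<noteq> (\<Phi> q m \<and> \<Psi> q m)}) \<le> \<epsilon> * real y)"
    proof (intro exI[of _ "\<lambda>p. c p * D + d p"] conjI ballI impI)
      fix p assume p: "p \<in> P"
      have "c p * D + d p < (c p + 1) * D" using d(1) p by simp
      also have "\<dots> \<le> C * D" using c(1) p by (intro mult_right_mono) auto
      finally show "c p * D + d p < C * D" .
    next
      fix p q assume pq: "p \<in> P" "q \<in> P" "c p * D + d p = c q * D + d q"
      have "d p = d q"
        using arg_cong[OF pq(3), of "\<lambda>t. t mod D"] d(1) pq(1,2) by simp
      moreover from this have "c p = c q" using pq(1,3) d(1) by fastforce
      ultimately have "real (card {m \<in> {1..y}. \<Phi> p m \<noteq> \<Phi> q m}) \<le> \<epsilon> / 2 * real y"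
        "real (card {m \<in> {1..y}. \<Psi> p m \<noteq> \<Psi> q m}) \<le> \<epsilon> / 2 * real y"
        using c(2) d(2) pq by blast+
      moreover have "card {m \<in> {1..y}. (\<Phi> p m \<and> \<Psi> p m) \<noteq> (\<Phi> q m \<and> \<Psi> q m)} \<le>
        card ({m \<in> {1..y}. \<Phi> p m \<noteq> \<Phi> q m} \<union> {m \<in> {1..y}. \<Psi> p m \<noteq> \<Psi> q m})"
        by (intro card_mono) auto
      moreover have "\<dots> \<le> card {m \<in> {1..y}. \<Phi> p m \<noteq> \<Phi> q m} + card {m \<in> {1..y}. \<Psi> p m \<noteq> \<Psi> q m}"
        by (rule card_Un_le)
      ultimately show "real (card {m \<in> {1..y}. (\<Phi> p m \<and> \<Psi> p m) \<noteq> (\<Phi> q m \<and> \<Psi> q m)}) \<le> \<epsilon> * real y"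
        by linarith
    qed
  qed
qed

lemma uniformly_totally_bounded_disj:
  assumes "uniformly_totally_bounded P \<Phi>" and "uniformly_totally_bounded P \<Psi>"
  shows "uniformly_totally_bounded P (\<lambda>p m. \<Phi> p m \<or> \<Psi> p m)"
  using uniformly_totally_bounded_not[OF uniformly_totally_bounded_conj
      [OF assms[THEN uniformly_totally_bounded_not]]] by simp

lemma uniformly_totally_bounded_Bex:
  assumes "finite F" and "\<And>i. i \<in> F \<Longrightarrow> uniformly_totally_bounded P (\<Phi> i)"
  shows "uniformly_totally_bounded P (\<lambda>p m. \<exists>i\<in>F. \<Phi> i p m)"
  using assms
  by (induction F) (auto intro: uniformly_totally_bounded_fixed_set uniformly_totally_bounded_disj)

lemma uniformly_totally_bounded_Ball:
  assumes "finite F" and "\<And>i. i \<in> F \<Longrightarrow> uniformly_totally_bounded P (\<Phi> i)"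
  shows "uniformly_totally_bounded P (\<lambda>p m. \<forall>i\<in>F. \<Phi> i p m)"
  using assms
  by (induction F) (auto intro: uniformly_totally_bounded_fixed_set uniformly_totally_bounded_conj)

text \<open>
  This is where all compactness comes from. Two nested sets differ by exactly the difference of
  their cardinalities, so members of a chain with nearly the same number of elements in \<open>{1..y}\<close>
  are close to each other. Colouring by the cardinality, rounded to multiples of \<open>\<epsilon> * y\<close>, uses about
  \<open>1 / \<epsilon>\<close> colours whatever the chain is.
\<close>

lemma uniformly_totally_bounded_chain:
  assumes chain: "\<And>p q. p \<in> P \<Longrightarrow> q \<in> P \<Longrightarrow> (\<forall>m. \<Phi> p m \<longrightarrow> \<Phi> q m) \<or> (\<forall>m. \<Phi> q m \<longrightarrow> \<Phi> p m)"
  shows "uniformly_totally_bounded P \<Phi>"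
  unfolding uniformly_totally_bounded_def
proof (intro allI impI)
  fix \<epsilon> :: real assume \<epsilon>: "\<epsilon> > 0"
  define C where "C = nat \<lfloor>1 / \<epsilon>\<rfloor> + 1"
  show "\<exists>C. \<forall>y. \<exists>c::nat \<Rightarrow> nat. (\<forall>p\<in>P. c p < C) \<and> (\<forall>p\<in>P. \<forall>q\<in>P. c p = c q \<longrightarrow>
      real (card {m \<in> {1..y}. \<Phi> p m \<noteq> \<Phi> q m}) \<le> \<epsilon> * real y)"
  proof (intro exI[of _ C] allI)
    fix y :: nat
    define N where "N p = card {m \<in> {1..y}. \<Phi> p m}" for p
    define c where "c p = nat \<lfloor>real (N p) / (\<epsilon> * real y)\<rfloor>" for p
    have "c p < C" for p
    proof -
      have "N p \<le> card {1..y}" unfolding N_def by (intro card_mono) auto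
      then have "real (N p) / (\<epsilon> * real y) \<le> 1 / \<epsilon>"
        using \<epsilon> by (cases "y = 0") (auto simp: field_simps)
      then have "c p \<le> nat \<lfloor>1 / \<epsilon>\<rfloor>" unfolding c_def by (intro nat_mono floor_mono)
      then show ?thesis by (simp add: C_def)
    qed
    moreover have nested: "real (card {m \<in> {1..y}. \<Phi> p m \<noteq> \<Phi> q m}) \<le> \<epsilon> * real y"
      if eq: "c p = c q" and sub: "\<forall>m. \<Phi> p m \<longrightarrow> \<Phi> q m" for p q
    proof (cases "y = 0")
      case False
      define t where "t = \<epsilon> * real y"
      have t: "t > 0" using False \<epsilon> by (simp add: t_def)
      have "{m \<in> {1..y}. \<Phi> p m \<noteq> \<Phi> q m} = {m \<in> {1..y}. \<Phi> q m} - {m \<in> {1..y}. \<Phi> p m}"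
        using sub by auto
      then have "real (card {m \<in> {1..y}. \<Phi> p m \<noteq> \<Phi> q m}) = real (N q) - real (N p)"
        unfolding N_def using sub by (simp add: card_Diff_subset card_mono of_nat_diff Collect_mono_iff)
      moreover have "\<lfloor>real (N p) / t\<rfloor> = \<lfloor>real (N q) / t\<rfloor>"
        using eq t unfolding c_def t_def[symmetric] by (simp add: nat_eq_iff)
      then have "real (N q) / t - real (N p) / t \<le> 1" by linarith
      then have "real (N q) - real (N p) \<le> t"
        using t by (simp add: diff_divide_distrib[symmetric] field_simps)
      ultimately show ?thesis by (simp add: t_def)
    qed simp
    have "real (card {m \<in> {1..y}. \<Phi> p m \<noteq> \<Phi> q m}) \<le> \<epsilon> * real y"
      if "c p = c q" "p \<in> P" "q \<in> P" for p q
      using chain[OF that(2,3)]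
    proof
      assume "\<forall>m. \<Phi> q m \<longrightarrow> \<Phi> p m"
      moreover have "{m \<in> {1..y}. \<Phi> q m \<noteq> \<Phi> p m} = {m \<in> {1..y}. \<Phi> p m \<noteq> \<Phi> q m}" by blast
      ultimately show ?thesis using nested[of q p] that(1) by simp
    qed (use nested that(1) in blast)
    ultimately show "\<exists>c::nat \<Rightarrow> nat. (\<forall>p\<in>P. c p < C) \<and> (\<forall>p\<in>P. \<forall>q\<in>P. c p = c q \<longrightarrow>
        real (card {m \<in> {1..y}. \<Phi> p m \<noteq> \<Phi> q m}) \<le> \<epsilon> * real y)" by blast
  qed
qed

text \<open>
  An interval is the intersection of the upward closed and the downward closed set that it
  generates, and each of these two pulls back to a chain.
\<close>

lemma uniformly_totally_bounded_interval:
  fixes h :: "nat \<Rightarrow> nat \<Rightarrow> real"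
  assumes mono: "\<And>p q. p \<in> P \<Longrightarrow> q \<in> P \<Longrightarrow> (\<forall>m. h p m \<le> h q m) \<or> (\<forall>m. h q m \<le> h p m)"
    and I: "is_interval I"
  shows "uniformly_totally_bounded P (\<lambda>p m. h p m \<in> I)"
proof -
  have iff: "h p m \<in> I \<longleftrightarrow> (\<exists>i\<in>I. i \<le> h p m) \<and> (\<exists>i\<in>I. h p m \<le> i)" for p m
    using I unfolding is_interval_1 by blast
  have "uniformly_totally_bounded P (\<lambda>p m. \<exists>i\<in>I. i \<le> h p m)"
  proof (rule uniformly_totally_bounded_chain)
    fix p q assume "p \<in> P" "q \<in> P"
    from mono[OF this] show "(\<forall>m. (\<exists>i\<in>I. i \<le> h p m) \<longrightarrow> (\<exists>i\<in>I. i \<le> h q m)) \<or>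
      (\<forall>m. (\<exists>i\<in>I. i \<le> h q m) \<longrightarrow> (\<exists>i\<in>I. i \<le> h p m))" by (meson order_trans)
  qed
  moreover have "uniformly_totally_bounded P (\<lambda>p m. \<exists>i\<in>I. h p m \<le> i)"
  proof (rule uniformly_totally_bounded_chain)
    fix p q assume "p \<in> P" "q \<in> P"
    from mono[OF this] show "(\<forall>m. (\<exists>i\<in>I. h p m \<le> i) \<longrightarrow> (\<exists>i\<in>I. h q m \<le> i)) \<or>
      (\<forall>m. (\<exists>i\<in>I. h q m \<le> i) \<longrightarrow> (\<exists>i\<in>I. h p m \<le> i))" by (meson order_trans)
  qed
  ultimately show ?thesis unfolding iff by (rule uniformly_totally_bounded_conj)
qed

text \<open>
  If \<open>I\<close> contains two points at distance at least \<open>1\<close>, its translates by integers cover the line.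
  Otherwise \<open>I\<close> is bounded, and because \<open>s\<close> and \<open>t\<close> are bounded only finitely many translates
  matter.
\<close>

lemma uniformly_totally_bounded_interval_mod_1:
  fixes s t :: "nat \<Rightarrow> real"
  assumes s: "\<And>p. s p \<in> {0..B}" and t: "\<And>m. t m \<in> {0..B}" and I: "is_interval I"
  shows "uniformly_totally_bounded P (\<lambda>p m. \<exists>k::int. s p + t m + of_int k \<in> I)"
proof (cases "\<exists>a\<in>I. \<exists>b\<in>I. a + 1 \<le> b")
  case True
  then obtain a b where ab: "a \<in> I" "b \<in> I" "a + 1 \<le> b" by blast
  have "\<exists>k::int. x + of_int k \<in> I" for x
  proof (intro exI[of _ "\<lceil>a - x\<rceil>"])
    have "a \<le> x + of_int \<lceil>a - x\<rceil>" "x + of_int \<lceil>a - x\<rceil> \<le> b" using ab(3) by linarith+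
    then show "x + of_int \<lceil>a - x\<rceil> \<in> I" using I ab(1,2) unfolding is_interval_1 by blast
  qed
  then show ?thesis by (simp add: uniformly_totally_bounded_fixed_set)
next
  case short: False
  show ?thesis
  proof (cases "I = {}")
    case True
    then show ?thesis by (simp add: uniformly_totally_bounded_fixed_set)
  next
    case False
    then obtain a where a: "a \<in> I" by blast
    define J where "J = {\<lfloor>a - 1 - 2 * B\<rfloor>..\<lceil>a + 1\<rceil>}"
    have "k \<in> J" if "s p + t m + of_int k \<in> I" for p m and k :: int
    proof -
      have "\<not> s p + t m + of_int k + 1 \<le> a" "\<not> a + 1 \<le> s p + t m + of_int k"
        using short a that by blast+
      moreover have "0 \<le> s p" "s p \<le> B" "0 \<le> t m" "t m \<le> B"
        using s[of p] t[of m] by auto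
      ultimately have "a - 1 - 2 * B \<le> of_int k" "of_int k \<le> a + 1" by linarith+
      then show ?thesis unfolding J_def by (simp add: le_ceiling_iff floor_le_iff) linarith
    qed
    then have "(\<exists>k::int. s p + t m + of_int k \<in> I) \<longleftrightarrow> (\<exists>k\<in>J. s p + t m + of_int k \<in> I)" for p m
      by blast
    moreover have "uniformly_totally_bounded P (\<lambda>p m. \<exists>k\<in>J. s p + t m + of_int k \<in> I)"
    proof (rule uniformly_totally_bounded_Bex)
      fix k
      have "(\<forall>m. s p + t m + real_of_int k \<le> s q + t m + real_of_int k) \<or>
            (\<forall>m. s q + t m + real_of_int k \<le> s p + t m + real_of_int k)" for p q
        using linear[of "s p" "s q"] by simp
      then show "uniformly_totally_bounded P (\<lambda>p m. s p + t m + real_of_int k \<in> I)"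
        by (intro uniformly_totally_bounded_interval I)
    qed (simp add: J_def)
    ultimately show ?thesis by (simp only:)
  qed
qed

text \<open>
  The argument in units of a full turn, so that it matches the angles in \<open>polar_box\<close>.
\<close>

definition turn :: "complex \<Rightarrow> real" where
  "turn w = Arg2pi w / (2 * pi)"

lemma turn_bounds: "turn w \<in> {0..1}"
  using Arg2pi_ge_0[of w] Arg2pi_lt_2pi[of w] by (simp add: turn_def field_simps)

lemma polar_form: "w = of_real (cmod w) * exp (2 * of_real pi * \<i> * of_real (turn w))"
proof -
  have *: "2 * of_real pi * \<i> * of_real (turn w) = \<i> * of_real (Arg2pi w)"
    by (simp add: turn_def field_simps)
  show ?thesis
    using Arg2pi[of w] unfolding is_Arg_def * by blast
qed

text \<open>
  The second alternative accounts for negative radii: \<open>- r\<close> at angle \<open>\<phi>\<close> is \<open>r\<close> at angle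
  \<open>\<phi> + 1/2\<close>.
\<close>

lemma mem_polar_box_iff:
  assumes w: "w = of_real \<rho> * exp (2 * of_real pi * \<i> * of_real \<tau>)" and \<rho>: "\<rho> > 0"
  shows "w \<in> polar_box I1 I2 \<longleftrightarrow>
     \<rho> \<in> I1 \<and> (\<exists>k::int. \<tau> + of_int k \<in> I2) \<or>
     \<rho> \<in> uminus ` I1 \<and> (\<exists>k::int. \<tau> + 1/2 + of_int k \<in> I2)"
    (is "_ \<longleftrightarrow> ?R")
proof -
  define e where "e x = exp (2 * of_real pi * \<i> * of_real x)" for x :: real
  have e_shift: "e (x + of_int k) = e x" for x and k :: int
    by (auto simp: e_def exp_eq algebra_simps)
  have e_half: "e (x + 1/2) = - e x" for x
    by (simp add: e_def algebra_simps exp_add)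
  have e_eq: "\<exists>k::int. y = x + of_int k" if "e x = e y" for x y
  proof -
    from that[symmetric] obtain k :: int where
      "2 * of_real pi * \<i> * of_real y = 2 * of_real pi * \<i> * of_real x + (of_int (2 * k) * pi) * \<i>"
      unfolding e_def exp_eq by blast
    then have "2 * of_real pi * \<i> * (of_real y :: complex) = 2 * of_real pi * \<i> * (of_real (x + of_int k))"
      by (simp add: algebra_simps)
    then have "(of_real y :: complex) = of_real (x + of_int k)"
      by (subst (asm) mult_cancel_left) simp
    then show ?thesis using of_real_eq_iff by blast
  qed
  have norm_e: "cmod (e x) = 1" for x by (simp add: e_def)
  have w': "w = of_real \<rho> * e \<tau>" using w by (simp add: e_def)
  have box: "w \<in> polar_box I1 I2 \<longleftrightarrow> (\<exists>r \<phi>. w = of_real r * e \<phi> \<and> r \<in> I1 \<and> \<phi> \<in> I2)"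
    by (auto simp: polar_box_def e_def)
  show ?thesis
  proof
    assume "w \<in> polar_box I1 I2"
    then obtain r \<phi> where r: "w = of_real r * e \<phi>" "r \<in> I1" "\<phi> \<in> I2" using box by blast
    have "\<bar>r\<bar> = \<rho>"
      using arg_cong[OF r(1), of cmod] \<rho> by (simp add: w' norm_mult norm_e)
    then consider "r = \<rho>" | "r = - \<rho>" by linarith
    then show ?R
    proof cases
      case 1
      then have "e \<tau> = e \<phi>" using r(1) w' \<rho> by simp
      from e_eq[OF this] show ?thesis using 1 r by auto
    next
      case 2
      then have "e \<tau> = - e \<phi>"
        using r(1) w' \<rho> by (metis minus_mult_commute mult_cancel_left of_real_eq_0_iff of_real_minus less_irrefl)
      then have "e (\<tau> + 1/2) = e \<phi>" by (simp add: e_half)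
      from e_eq[OF this] have "\<exists>k::int. \<tau> + 1/2 + of_int k \<in> I2" using r(3) by auto
      moreover have "\<rho> \<in> uminus ` I1" using 2 r(2) by (intro image_eqI[of _ _ r]) auto
      ultimately show ?thesis by blast
    qed
  next
    assume ?R
    then consider k :: int where "\<rho> \<in> I1" "\<tau> + of_int k \<in> I2" |
      r and k :: int where "r \<in> I1" "\<rho> = - r" "\<tau> + 1/2 + of_int k \<in> I2" by blast
    then show "w \<in> polar_box I1 I2"
    proof cases
      case 1
      then show ?thesis using w' e_shift box by metis
    next
      case 2
      then have "w = of_real r * e (\<tau> + 1/2 + of_int k)"
        unfolding e_shift e_half using w' by simp
      then show ?thesis using 2 box by blast
    qed
  qed
qed

text \<open>
  Away from zero, membership of a product in a polar box is a condition on the product of the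
  moduli and on the sum of the angles modulo \<open>1\<close>. Both are monotone in the factor coming from
  \<open>p\<close>, so both reduce to chains.
\<close>

lemma uniformly_totally_bounded_polar_box:
  fixes u v :: "nat \<Rightarrow> complex"
  assumes "is_interval I1" and "is_interval I2"
  shows "uniformly_totally_bounded P (\<lambda>p m. u p * v m \<in> polar_box I1 I2)"
proof -
  define \<Phi> where "\<Phi> I J d p m \<longleftrightarrow> cmod (u p) * cmod (v m) \<in> I \<and>
     (\<exists>k::int. turn (u p) + (turn (v m) + d) + of_int k \<in> J)" for I J d p m
  have *: "uniformly_totally_bounded P (\<Phi> I J d)" if "is_interval I" "is_interval J" "d \<in> {0..1}" for I J d
  proof -
    have "uniformly_totally_bounded P (\<lambda>p m. cmod (u p) * cmod (v m) \<in> I)"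
      by (intro uniformly_totally_bounded_interval that(1))
        (metis linear mult_right_mono norm_ge_zero)
    moreover have "uniformly_totally_bounded P
        (\<lambda>p m. \<exists>k::int. turn (u p) + (turn (v m) + d) + of_int k \<in> J)"
    proof (rule uniformly_totally_bounded_interval_mod_1[OF _ _ that(2)])
      show "turn (u p) \<in> {0..2}" for p using turn_bounds[of "u p"] by simp
      show "turn (v m) + d \<in> {0..2}" for m using turn_bounds[of "v m"] that(3) by simp
    qed
    ultimately show ?thesis
      unfolding \<Phi>_def by (rule uniformly_totally_bounded_conj)
  qed
  have iff: "u p * v m \<in> polar_box I1 I2 \<longleftrightarrow>
      (\<not> (u p \<noteq> 0 \<and> v m \<noteq> 0) \<and> 0 \<in> polar_box I1 I2) \<or>
      ((u p \<noteq> 0 \<and> v m \<noteq> 0) \<and> (\<Phi> I1 I2 0 p m \<or> \<Phi> (uminus ` I1) I2 (1/2) p m))" for p m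
  proof (cases "u p \<noteq> 0 \<and> v m \<noteq> 0")
    case True
    have "u p * v m = of_real (cmod (u p) * cmod (v m)) *
        exp (2 * of_real pi * \<i> * of_real (turn (u p) + turn (v m)))"
      by (subst polar_form[of "u p"], subst polar_form[of "v m"]) (simp add: exp_add algebra_simps)
    from mem_polar_box_iff[OF this] True show ?thesis by (simp add: \<Phi>_def add.assoc)
  qed auto
  show ?thesis
    unfolding iff using assms
    by (intro uniformly_totally_bounded_disj uniformly_totally_bounded_conj
        uniformly_totally_bounded_not uniformly_totally_bounded_fixed_set
        uniformly_totally_bounded_all_or_nothing *) (auto simp: is_interval_uminus)
qed

lemma uniformly_totally_bounded_elementary_polar:
  fixes u v :: "nat \<Rightarrow> complex"
  assumes "elementary_polar K"
  shows "uniformly_totally_bounded P (\<lambda>p m. u p * v m \<in> K)"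
proof -
  obtain F where F: "finite F" "\<And>I1 I2. (I1, I2) \<in> F \<Longrightarrow> is_interval I1 \<and> is_interval I2"
    "K = (\<Union>(I1, I2)\<in>F. polar_box I1 I2)"
    using assms unfolding elementary_polar_def by blast
  have "uniformly_totally_bounded P (\<lambda>p m. \<exists>i\<in>F. u p * v m \<in> polar_box (fst i) (snd i))"
    using F(1,2) by (intro uniformly_totally_bounded_Bex uniformly_totally_bounded_polar_box) auto
  then show ?thesis by (simp add: F(3) case_prod_unfold)
qed

text \<open>
  A point is a degenerate polar box; thus level sets of multiplicative functions are treated
  together with the preimages of elementary sets.
\<close>

lemma elementary_polar_singleton: "elementary_polar {z}"
  unfolding elementary_polar_def
proof (intro exI conjI)
  show "finite {({cmod z}, {turn z})}" by simp
  show "{z} = (\<Union>(I1, I2)\<in>{({cmod z}, {turn z})}. polar_box I1 I2)"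
    using polar_form[of z] by (simp add: polar_box_def)
qed (simp add: is_interval_1)

section \<open>Prime divisors on average\<close>

lemma sum_multiples:
  fixes b :: "nat \<Rightarrow> 'a::comm_monoid_add"
  assumes "d > 0"
  shows "(\<Sum>n | n \<in> {1..X} \<and> d dvd n. b n) = (\<Sum>m=1..X div d. b (d * m))"
proof (rule sum.reindex_bij_witness[of _ "\<lambda>m. d * m" "\<lambda>n. n div d"])
  fix n assume "n \<in> {n. n \<in> {1..X} \<and> d dvd n}"
  then show "n div d \<in> {1..X div d}" "d * (n div d) = n"
    using assms by (auto simp: div_le_mono div_greater_zero_iff dvd_imp_le Suc_le_eq)
  then show "b (d * (n div d)) = b n" by simp
next
  fix m assume m: "m \<in> {1..X div d}"
  then show "d * m \<in> {n. n \<in> {1..X} \<and> d dvd n}"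
    using assms by (auto simp: less_eq_div_iff_mult_less_eq mult.commute)
  show "d * m div d = m" using assms by simp
qed

lemma card_multiples:
  assumes "d > 0"
  shows "card {n \<in> {1..X}. d dvd n} = X div d"
  using sum_multiples[OF assms, of "\<lambda>_. 1::nat" X] by simp

text \<open>
  The number of prime divisors in \<open>Q\<close> of an integer \<open>n \<le> X\<close> has mean and variance about \<open>A\<close>: on
  average over \<open>n\<close>, divisibility by distinct primes is independent. Expanding the square needs the
  first moment from below and the second from above only.
\<close>

lemma Turan_Kubilius:
  fixes Q :: "nat set" and X :: nat
  assumes fin: "finite Q" and primes: "\<And>p. p \<in> Q \<Longrightarrow> prime p"
  defines "A \<equiv> \<Sum>p\<in>Q. 1 / real p"
  shows "(\<Sum>n=1..X. (real (card {p \<in> Q. p dvd n}) - A)\<^sup>2) \<le> real X * A + 2 * A * real (card Q)"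
proof -
  define I :: "nat \<Rightarrow> nat \<Rightarrow> real" where "I p n = of_bool (p dvd n)" for p n
  have \<omega>: "real (card {p \<in> Q. p dvd n}) = (\<Sum>p\<in>Q. I p n)" for n
    using fin by (simp add: I_def sum.If_cases Int_def of_bool_def)
  have pos: "p > 0" if "p \<in> Q" for p using primes[OF that] by (rule prime_gt_0_nat)
  have A0: "A \<ge> 0" unfolding A_def by (intro sum_nonneg) simp
  have count: "(\<Sum>n=1..X. of_bool (d dvd n)) = real (X div d)" if "d > 0" for d
  proof -
    have "(\<Sum>n=1..X. of_bool (d dvd n)) = real (card {n \<in> {1..X}. d dvd n})"
      by (simp add: sum.If_cases Int_def of_bool_def)
    then show ?thesis using card_multiples[OF that] by simp
  qed
  have "(\<Sum>n=1..X. \<Sum>p\<in>Q. I p n) = (\<Sum>p\<in>Q. real (X div p))"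
    unfolding I_def by (subst sum.swap) (intro sum.cong refl count pos)
  moreover have "(\<Sum>p\<in>Q. real X * (1 / real p) - 1) \<le> (\<Sum>p\<in>Q. real (X div p))"
  proof (rule sum_mono)
    fix p
    show "real X * (1 / real p) - 1 \<le> real (X div p)"
      using floor_divide_of_nat_eq[of X p, where ?'a = real] by simp linarith
  qed
  ultimately have first: "real X * A - real (card Q) \<le> (\<Sum>n=1..X. \<Sum>p\<in>Q. I p n)"
    by (simp add: A_def sum_subtractf sum_distrib_left)
  have pair: "(\<Sum>n=1..X. I p n * I q n) \<le> real X * (1 / real p * (1 / real q)) + (if p = q then real X * (1 / real p) else 0)"
    if pq: "p \<in> Q" "q \<in> Q" for p q
  proof (cases "p = q")
    case True
    have "(\<Sum>n=1..X. I p n * I q n) = real (X div p)"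
      using True count[OF pos[OF pq(1)]] by (simp add: I_def flip: of_bool_conj)
    also have "\<dots> \<le> real X / real p" by (rule of_nat_div_le_of_nat)
    finally show ?thesis using True by (simp add: add_increasing)
  next
    case False
    then have "coprime p q" using primes pq by (intro primes_coprime) auto
    then have "p * q dvd n \<longleftrightarrow> p dvd n \<and> q dvd n" for n
      by (meson divides_mult dvd_mult_left dvd_mult_right)
    then have "(\<Sum>n=1..X. I p n * I q n) = real (X div (p * q))"
      using count[of "p * q"] pos pq by (simp add: I_def flip: of_bool_conj)
    also have "\<dots> \<le> real X / real (p * q)" by (rule of_nat_div_le_of_nat)
    finally show ?thesis using False by simp
  qed
  have "(\<Sum>n=1..X. (\<Sum>p\<in>Q. I p n)\<^sup>2) = (\<Sum>p\<in>Q. \<Sum>q\<in>Q. \<Sum>n=1..X. I p n * I q n)"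
    unfolding power2_eq_square sum_product
    by (rule trans[OF sum.swap], rule sum.cong[OF refl], rule sum.swap)
  also have "\<dots> \<le> (\<Sum>p\<in>Q. \<Sum>q\<in>Q. real X * (1 / real p * (1 / real q)) + (if p = q then real X * (1 / real p) else 0))"
    by (intro sum_mono pair)
  also have "\<dots> = (\<Sum>p\<in>Q. \<Sum>q\<in>Q. real X * (1 / real p * (1 / real q))) + real X * A"
    using fin by (simp add: sum.distrib A_def sum_distrib_left)
  also have "(\<Sum>p\<in>Q. \<Sum>q\<in>Q. real X * (1 / real p * (1 / real q))) = real X * A\<^sup>2"
    unfolding A_def power2_eq_square sum_product by (simp only: sum_distrib_left)
  finally have second: "(\<Sum>n=1..X. (\<Sum>p\<in>Q. I p n)\<^sup>2) \<le> real X * A\<^sup>2 + real X * A" .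
  have "(\<Sum>n=1..X. ((\<Sum>p\<in>Q. I p n) - A)\<^sup>2) =
      (\<Sum>n=1..X. (\<Sum>p\<in>Q. I p n)\<^sup>2) - 2 * A * (\<Sum>n=1..X. \<Sum>p\<in>Q. I p n) + real X * A\<^sup>2"
    by (simp add: power2_diff sum.distrib sum_subtractf sum_distrib_left mult.assoc mult.commute[of _ A])
  also have "\<dots> \<le> (real X * A\<^sup>2 + real X * A) - 2 * A * (real X * A - real (card Q)) + real X * A\<^sup>2"
    using A0 by (intro add_mono diff_mono second mult_left_mono first) auto
  also have "\<dots> = real X * A + 2 * A * real (card Q)"
    by (simp add: algebra_simps power2_eq_square)
  finally show ?thesis by (simp add: \<omega>)
qed

text \<open>
  Writing \<open>n = s * t\<^sup>2\<close> with \<open>s\<close> squarefree leaves at most \<open>2 ^ card S\<close> choices for \<open>s\<close> and \<open>X\<close>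
  choices for \<open>t\<close>.
\<close>

lemma card_smooth_le:
  fixes S :: "nat set" and X :: nat
  assumes "finite S"
  shows "card {n \<in> {1..X\<^sup>2}. prime_factors n \<subseteq> S} \<le> 2 ^ card S * X"
proof -
  define g where "g n = (prime_factors (squarefree_part n), square_part n)" for n :: nat
  have "inj_on g {n \<in> {1..X\<^sup>2}. prime_factors n \<subseteq> S}"
  proof (rule inj_onI)
    fix m n assume eq: "g m = g n"
    have "squarefree_part k = \<Prod>(prime_factors (squarefree_part k))" for k :: nat
    proof -
      have "(\<Prod>p\<in>prime_factors (squarefree_part k). p ^ multiplicity p (squarefree_part k)) = squarefree_part k"
        by (rule prime_factorization_nat[symmetric]) (simp add: zero_less_iff_neq_zero)
      moreover have "multiplicity p (squarefree_part k) = 1" if "p \<in> prime_factors (squarefree_part k)" for p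
        using squarefree_factorial_semiring''[of "squarefree_part k"] that
        by (auto simp: prime_factors_multiplicity le_antisym Suc_le_eq)
      ultimately show ?thesis by simp
    qed
    then have "squarefree_part m = squarefree_part n" using eq unfolding g_def by (metis fst_conv)
    moreover have "square_part m = square_part n" using eq by (simp add: g_def)
    ultimately show "m = n" using squarefree_decompose by metis
  qed
  moreover have "g ` {n \<in> {1..X\<^sup>2}. prime_factors n \<subseteq> S} \<subseteq> Pow S \<times> {1..X}"
  proof (rule image_subsetI)
    fix n assume n: "n \<in> {n \<in> {1..X\<^sup>2}. prime_factors n \<subseteq> S}"
    have "squarefree_part n dvd n" by (metis dvd_triv_left squarefree_decompose)
    then have "prime_factors (squarefree_part n) \<subseteq> S"
      using n dvd_prime_factors[of n "squarefree_part n"] by auto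
    moreover have "square_part n ^ 2 \<le> n"
      using n by (intro dvd_imp_le square_part_square_dvd) auto
    then have "square_part n ^ 2 \<le> X\<^sup>2" by (rule order_trans) (use n in simp)
    then have "square_part n \<le> X" by (rule power2_le_imp_le) simp
    moreover have "square_part n > 0" using n by (auto intro: Nat.gr0I)
    ultimately show "g n \<in> Pow S \<times> {1..X}" by (simp add: g_def)
  qed
  ultimately have "card {n \<in> {1..X\<^sup>2}. prime_factors n \<subseteq> S} \<le> card (Pow S \<times> {1..X})"
    using assms by (intro card_inj_on_le) auto
  then show ?thesis using assms by (simp add: card_cartesian_product card_Pow)
qed

text \<open>
  This is the argument of Erdos: if the sum converged, a finite set \<open>S\<close> of primes would carry all but less than
  \<open>1/2\<close> of it. Among the integers up to a large square, fewer than half have a prime factor outside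
  \<open>S\<close>, and those composed of primes in \<open>S\<close> are too rare to make up the rest.
\<close>

lemma not_summable_prime_reciprocals: "\<not> (\<lambda>p. 1 / real p) summable_on {p::nat. prime p}"
proof
  assume summable: "(\<lambda>p. 1 / real p) summable_on {p::nat. prime p}"
  then obtain s where s: "((\<lambda>p. 1 / real p) has_sum s) {p::nat. prime p}"
    unfolding summable_on_def by blast
  have "\<forall>\<^sub>F F in finite_subsets_at_top {p::nat. prime p}. s - 1/2 < (\<Sum>p\<in>F. 1 / real p)"
    using s unfolding has_sum_def by (rule order_tendstoD) simp
  then obtain S where S: "finite S" "S \<subseteq> {p::nat. prime p}" "s - 1/2 < (\<Sum>p\<in>S. 1 / real p)"
    unfolding eventually_finite_subsets_at_top by blast
  \<comment> \<open>Chosen so that the bound \<open>2 ^ card S * X\<close> for the smooth numbers is exactly half of \<open>X\<^sup>2\<close>.\<close>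
  define X where "X = 2 * 2 ^ card S * (1::nat)"
  have X: "X > 0" by (simp add: X_def)
  define R where "R = {p. prime p \<and> p \<le> X\<^sup>2} - S"
  have R: "finite R" "\<And>p. p \<in> R \<Longrightarrow> prime p"
    unfolding R_def by (auto intro: finite_subset[of _ "{..X\<^sup>2}"])
  have tail: "(\<Sum>p\<in>R. 1 / real p) < 1/2"
  proof -
    have "(\<Sum>p\<in>S \<union> R. 1 / real p) \<le> s"
      using S R by (intro finite_sum_le_has_sum[OF s]) auto
    moreover have "(\<Sum>p\<in>S \<union> R. 1 / real p) = (\<Sum>p\<in>S. 1 / real p) + (\<Sum>p\<in>R. 1 / real p)"
      using S(1) R(1) by (intro sum.union_disjoint) (auto simp: R_def)
    ultimately show ?thesis using S(3) by linarith
  qed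
  have "{1..X\<^sup>2} \<subseteq> {n \<in> {1..X\<^sup>2}. prime_factors n \<subseteq> S} \<union> (\<Union>p\<in>R. {n \<in> {1..X\<^sup>2}. p dvd n})"
  proof
    fix n assume n: "n \<in> {1..X\<^sup>2}"
    show "n \<in> {n \<in> {1..X\<^sup>2}. prime_factors n \<subseteq> S} \<union> (\<Union>p\<in>R. {n \<in> {1..X\<^sup>2}. p dvd n})"
    proof (cases "prime_factors n \<subseteq> S")
      case False
      then obtain p where "prime p" "p dvd n" "p \<notin> S" by (auto simp: prime_factors_dvd)
      moreover from this have "p \<le> X\<^sup>2" using n dvd_imp_le[of p n] by auto
      ultimately show ?thesis using n by (auto simp: R_def)
    qed (use n in auto)
  qed
  then have "card {1..X\<^sup>2} \<le> card ({n \<in> {1..X\<^sup>2}. prime_factors n \<subseteq> S} \<union> (\<Union>p\<in>R. {n \<in> {1..X\<^sup>2}. p dvd n}))"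
    using R(1) by (intro card_mono) auto
  also have "\<dots> \<le> 2 ^ card S * X + (\<Sum>p\<in>R. card {n \<in> {1..X\<^sup>2}. p dvd n})"
    using card_smooth_le[OF S(1)] card_UN_le[OF R(1)]
    by (intro order_trans[OF card_Un_le] add_mono) auto
  also have "(\<Sum>p\<in>R. card {n \<in> {1..X\<^sup>2}. p dvd n}) = (\<Sum>p\<in>R. X\<^sup>2 div p)"
    using R(2) prime_gt_0_nat by (intro sum.cong refl card_multiples) auto
  finally have "real (X\<^sup>2) \<le> real (2 ^ card S * X + (\<Sum>p\<in>R. X\<^sup>2 div p))"
    using of_nat_mono by (simp only: card_atLeastAtMost diff_Suc_1 One_nat_def)
  also have "\<dots> = real (2 ^ card S * X) + (\<Sum>p\<in>R. real (X\<^sup>2 div p))"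
    by (simp only: of_nat_add of_nat_sum)
  also have "(\<Sum>p\<in>R. real (X\<^sup>2 div p)) \<le> (\<Sum>p\<in>R. real (X\<^sup>2) * (1 / real p))"
    using of_nat_div_le_of_nat[of "X\<^sup>2"] by (intro sum_mono) simp
  also have "\<dots> = real (X\<^sup>2) * (\<Sum>p\<in>R. 1 / real p)" by (simp add: sum_distrib_left)
  also have "\<dots> < real (X\<^sup>2) * (1/2)"
    using tail X by (intro mult_strict_left_mono) auto
  also have "real (2 ^ card S * X) = real (X\<^sup>2) / 2"
    by (simp add: X_def power2_eq_square)
  finally show False by simp
qed

lemma sum_reciprocal_squares_le:
  assumes "finite Q" and "0 \<notin> Q"
  shows "(\<Sum>p\<in>Q. 1 / (real p)\<^sup>2) \<le> 2"
proof -
  have partial: "(\<Sum>n=1..N. 1 / (real n)\<^sup>2) \<le> 2 - 1 / real N" if "N \<ge> 1" for N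
    using that
  proof (induction N rule: dec_induct)
    case (step N)
    have "1 / (real (Suc N))\<^sup>2 \<le> 1 / (real N * real (Suc N))"
      using step by (intro frac_le) (auto simp: power2_eq_square)
    also have "\<dots> = 1 / real N - 1 / real (Suc N)"
      using step by (simp add: field_simps)
    finally show ?case using step by simp
  qed simp
  define N where "N = Max (insert 1 Q)"
  have "x \<le> N" if "x \<in> insert 1 Q" for x
    unfolding N_def using assms(1) that by (intro Max_ge) auto
  moreover have "x \<ge> 1" if "x \<in> Q" for x using that assms(2) by (cases x) auto
  ultimately have "N \<ge> 1" "Q \<subseteq> {1..N}" by auto
  then have "(\<Sum>p\<in>Q. 1 / (real p)\<^sup>2) \<le> (\<Sum>n=1..N. 1 / (real n)\<^sup>2)"
    by (intro sum_mono2) auto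
  also have "\<dots> \<le> 2 - 1 / real N" by (rule partial) fact
  also have "\<dots> \<le> 2" by simp
  finally show ?thesis .
qed

lemma sum_divisor_count:
  fixes b :: "nat \<Rightarrow> complex"
  assumes "finite Q" and "\<And>p. p \<in> Q \<Longrightarrow> p > 0"
  shows "(\<Sum>n=1..X. of_nat (card {p \<in> Q. p dvd n}) * b n) = (\<Sum>p\<in>Q. \<Sum>m=1..X div p. b (p * m))"
proof -
  have "(\<Sum>n=1..X. of_nat (card {p \<in> Q. p dvd n}) * b n) = (\<Sum>n=1..X. \<Sum>p\<in>Q. if p dvd n then b n else 0)"
    using assms(1) by (intro sum.cong refl) (simp add: sum.If_cases Int_def)
  also have "\<dots> = (\<Sum>p\<in>Q. \<Sum>n=1..X. if p dvd n then b n else 0)"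
    by (rule sum.swap)
  also have "\<dots> = (\<Sum>p\<in>Q. \<Sum>n | n \<in> {1..X} \<and> p dvd n. b n)"
    by (intro sum.cong refl sum.mono_neutral_cong_right) auto
  also have "\<dots> = (\<Sum>p\<in>Q. \<Sum>m=1..X div p. b (p * m))"
    by (intro sum.cong refl sum_multiples assms(2))
  finally show ?thesis .
qed

text \<open>
  As almost all \<open>n \<le> X\<close> have about \<open>A\<close> prime divisors in \<open>Q\<close>, multiplying \<open>b n\<close> by their number is the
  same as multiplying it by \<open>A\<close>, up to an error of relative size \<open>1 / sqrt A\<close>. The resulting sum is a
  sum over pairs \<open>(p, m)\<close> with \<open>p * m \<le> X\<close>.
\<close>

lemma Turan_Kubilius_weighted:
  fixes b :: "nat \<Rightarrow> complex"
  assumes fin: "finite Q" and primes: "\<And>p. p \<in> Q \<Longrightarrow> prime p"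
    and bound: "\<And>n. n \<ge> 1 \<Longrightarrow> cmod (b n) \<le> M"
    and X: "2 * card Q \<le> X"
  defines "A \<equiv> \<Sum>p\<in>Q. 1 / real p"
  shows "A * cmod (\<Sum>n=1..X. b n) \<le>
    cmod (\<Sum>p\<in>Q. \<Sum>m=1..X div p. b (p * m)) + M * (real X * sqrt (2 * A))"
proof -
  define w where "w n = real (card {p \<in> Q. p dvd n})" for n
  have M: "M \<ge> 0" using bound[of 1] by (meson norm_ge_zero order_trans le_refl)
  have A0: "A \<ge> 0" unfolding A_def by (intro sum_nonneg) simp
  have dev: "(\<Sum>n=1..X. \<bar>w n - A\<bar>) \<le> real X * sqrt (2 * A)"
  proof (rule power2_le_imp_le)
    have "(\<Sum>n=1..X. \<bar>w n - A\<bar>)\<^sup>2 \<le> (\<Sum>n=1..X. \<bar>w n - A\<bar>\<^sup>2) * real (card {1..X})"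
      by (rule sum_squared_le_sum_of_squares)
    also have "\<dots> = (\<Sum>n=1..X. (w n - A)\<^sup>2) * real X" by simp
    also have "\<dots> \<le> (real X * A + 2 * A * real (card Q)) * real X"
      unfolding w_def A_def by (intro mult_right_mono Turan_Kubilius fin primes) auto
    also have "\<dots> \<le> (real X * A + A * real X) * real X"
    proof -
      have "A * (2 * real (card Q)) \<le> A * real X" using X A0 by (intro mult_left_mono) linarith+
      then show ?thesis by (intro mult_right_mono) (auto simp: mult_ac)
    qed
    also have "\<dots> = (real X * sqrt (2 * A))\<^sup>2"
      using A0 by (simp add: power_mult_distrib) (simp add: power2_eq_square)
    finally show "(\<Sum>n=1..X. \<bar>w n - A\<bar>)\<^sup>2 \<le> (real X * sqrt (2 * A))\<^sup>2" .
  qed (use A0 in auto)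
  have "of_real A * (\<Sum>n=1..X. b n) = (\<Sum>n=1..X. of_real (w n) * b n) - (\<Sum>n=1..X. of_real (w n - A) * b n)"
    by (simp add: sum_distrib_left algebra_simps flip: sum_subtractf)
  then have "cmod (of_real A * (\<Sum>n=1..X. b n)) \<le>
      cmod (\<Sum>n=1..X. of_real (w n) * b n) + cmod (\<Sum>n=1..X. of_real (w n - A) * b n)"
    by (metis norm_triangle_ineq4)
  also have "cmod (of_real A * (\<Sum>n=1..X. b n)) = A * cmod (\<Sum>n=1..X. b n)"
    using A0 by (simp add: norm_mult)
  also have "(\<Sum>n=1..X. of_real (w n) * b n) = (\<Sum>p\<in>Q. \<Sum>m=1..X div p. b (p * m))"
    unfolding w_def of_real_of_nat_eq
    by (intro sum_divisor_count fin) (use primes prime_gt_0_nat in blast)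
  also have "cmod (\<Sum>n=1..X. of_real (w n - A) * b n) \<le> (\<Sum>n=1..X. M * \<bar>w n - A\<bar>)"
  proof (rule sum_norm_le)
    fix n assume "n \<in> {1..X}"
    then show "cmod (of_real (w n - A) * b n) \<le> M * \<bar>w n - A\<bar>"
      using mult_right_mono[OF bound, of n "\<bar>w n - A\<bar>"]
      by (simp only: norm_mult norm_of_real atLeastAtMost_iff mult.commute[of "cmod _"])
  qed
  also have "\<dots> \<le> M * (real X * sqrt (2 * A))"
    unfolding sum_distrib_left[symmetric] by (intro mult_left_mono dev M)
  finally show ?thesis by simp
qed

text \<open>
  Multiplicativity describes \<open>p * m \<in> E\<close> by \<open>\<Phi> p m\<close> only when \<open>p\<close> does not divide \<open>m\<close>. The remaining
  pairs number at most \<open>X / p\<^sup>2\<close> for each \<open>p\<close>, and the sum of \<open>1 / p\<^sup>2\<close> is bounded independently of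
  \<open>Q\<close>, so that this error is negligible against \<open>A * X\<close>.
\<close>

lemma coprimality_defect:
  fixes a :: "nat \<Rightarrow> complex" and X :: nat
  assumes fin: "finite Q" and primes: "\<And>p. p \<in> Q \<Longrightarrow> prime p"
    and bound: "\<And>n. n \<ge> 1 \<Longrightarrow> cmod (a n) \<le> M"
    and E: "\<And>p m. p \<in> Q \<Longrightarrow> m > 0 \<Longrightarrow> coprime p m \<Longrightarrow> p * m \<in> E \<longleftrightarrow> \<Phi> p m"
  shows "cmod (\<Sum>p\<in>Q. \<Sum>m=1..X div p. indicator E (p * m) * a (p * m)) \<le>
    cmod (\<Sum>p\<in>Q. \<Sum>m=1..X div p. of_bool (\<Phi> p m) * a (p * m)) + 2 * M * real X"
proof -
  define d where "d p m = (indicator E (p * m) - of_bool (\<Phi> p m)) * a (p * m)" for p m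
  have M: "M \<ge> 0" using bound[of 1] by (meson norm_ge_zero order_trans le_refl)
  have pos: "p > 0" if "p \<in> Q" for p using primes[OF that] by (rule prime_gt_0_nat)
  have defect: "cmod (\<Sum>m=1..X div p. d p m) \<le> M * real X * (1 / (real p)\<^sup>2)" if p: "p \<in> Q" for p
  proof -
    have "cmod (\<Sum>m=1..X div p. d p m) \<le> (\<Sum>m=1..X div p. if p dvd m then M else 0)"
    proof (rule sum_norm_le)
      fix m assume m: "m \<in> {1..X div p}"
      have le: "cmod (a (p * m)) \<le> M" using m pos[OF p] by (intro bound) simp
      show "cmod (d p m) \<le> (if p dvd m then M else 0)"
      proof (cases "p dvd m")
        case True
        have "cmod (indicator E (p * m) - of_bool (\<Phi> p m)) \<le> 1"
          by (cases "\<Phi> p m"; cases "p * m \<in> E") auto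
        from mult_mono[OF this le] show ?thesis using True by (simp add: d_def norm_mult)
      next
        case False
        then have "coprime p m" using primes[OF p] by (simp add: prime_imp_coprime)
        then show ?thesis using E[OF p] m False by (simp add: d_def indicator_def)
      qed
    qed
    also have "\<dots> = M * real (card {m \<in> {1..X div p}. p dvd m})"
      by (simp add: sum.If_cases Int_def mult.commute)
    also have "card {m \<in> {1..X div p}. p dvd m} = X div (p * p)"
      using card_multiples[OF pos[OF p]] by (simp add: div_mult2_eq)
    also have "M * real (X div (p * p)) \<le> M * (real X / real (p * p))"
      by (intro mult_left_mono of_nat_div_le_of_nat M)
    finally show ?thesis by (simp add: power2_eq_square)
  qed
  have split: "(\<Sum>p\<in>Q. \<Sum>m=1..X div p. indicator E (p * m) * a (p * m)) =
      (\<Sum>p\<in>Q. \<Sum>m=1..X div p. of_bool (\<Phi> p m) * a (p * m)) + (\<Sum>p\<in>Q. \<Sum>m=1..X div p. d p m)"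
    unfolding d_def sum.distrib[symmetric]
    by (intro sum.cong refl) (simp only: left_diff_distrib add_diff_eq add_diff_cancel_left')
  have "cmod (\<Sum>p\<in>Q. \<Sum>m=1..X div p. d p m) \<le> (\<Sum>p\<in>Q. M * real X * (1 / (real p)\<^sup>2))"
    by (intro sum_norm_le defect)
  also have "\<dots> = M * real X * (\<Sum>p\<in>Q. 1 / (real p)\<^sup>2)"
    by (simp only: sum_distrib_left)
  also have "\<dots> \<le> M * real X * 2"
    using pos M by (intro mult_left_mono sum_reciprocal_squares_le fin) auto
  finally have "cmod (\<Sum>p\<in>Q. \<Sum>m=1..X div p. d p m) \<le> 2 * M * real X" by simp
  then show ?thesis
    unfolding split by (rule norm_triangle_mono[OF order_refl])
qed

section \<open>Nearly orthogonal dilates\<close>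

text \<open>
  The sequences \<open>\<lambda>m. a (p * m)\<close>, for \<open>p\<close> in a finite set of primes, are nearly orthogonal. Expanding
  the square therefore leaves the diagonal, which is at most \<open>M\<^sup>2 * X\<close> because \<open>S\<close> has at most \<open>2 ^ k\<close>
  elements and \<open>m\<close> runs up to \<open>X div 2 ^ k\<close> only, and off-diagonal terms of total size at most
  \<open>M\<^sup>2 * X\<close>.
\<close>

lemma second_moment_nearly_orthogonal_dilates:
  fixes a :: "nat \<Rightarrow> complex" and S :: "nat set"
  assumes dyadic: "S \<subseteq> {2 ^ k..<2 ^ (k + 1)}"
    and bound: "\<And>n. n \<ge> 1 \<Longrightarrow> cmod (a n) \<le> M"
    and corr: "\<And>p q. p \<in> S \<Longrightarrow> q \<in> S \<Longrightarrow> p \<noteq> q \<Longrightarrow>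
      cmod (\<Sum>m=1..min (X div p) (X div q). a (p * m) * cnj (a (q * m))) \<le> \<delta> * real X"
    and \<delta>: "\<delta> \<ge> 0" "\<delta> * (real (card S))\<^sup>2 \<le> M\<^sup>2"
  shows "(\<Sum>m=1..X div 2 ^ k. (cmod (\<Sum>p | p \<in> S \<and> m \<le> X div p. a (p * m)))\<^sup>2) \<le> 2 * M\<^sup>2 * real X"
proof -
  define Y where "Y = X div 2 ^ k"
  have fin: "finite S" using dyadic finite_subset by blast
  have pos: "p > 0" if "p \<in> S" for p
    using dyadic that by (auto intro: less_le_trans[of 0 "2 ^ k"])
  define f where "f p m = of_bool (m \<le> X div p) * a (p * m)" for p m
  have sum_f: "(\<Sum>p | p \<in> S \<and> m \<le> X div p. a (p * m)) = (\<Sum>p\<in>S. f p m)" for m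
    unfolding f_def using fin by (intro sum.mono_neutral_cong_left) auto
  have pair: "cmod (\<Sum>m=1..Y. f p m * cnj (f q m)) \<le> (if p = q then M\<^sup>2 * real Y else 0) + \<delta> * real X"
    if pq: "p \<in> S" "q \<in> S" for p q
  proof -
    have le: "X div p \<le> Y" if "p \<in> S" for p
      using dyadic that unfolding Y_def by (intro div_le_mono2) auto
    have eq: "(\<Sum>m=1..Y. f p m * cnj (f q m)) = (\<Sum>m=1..min (X div p) (X div q). a (p * m) * cnj (a (q * m)))"
      using le[OF pq(1)] by (intro sum.mono_neutral_cong_right) (auto simp: f_def)
    show ?thesis
    proof (cases "p = q")
      case True
      have "cmod (\<Sum>m=1..Y. f p m * cnj (f q m)) \<le> (\<Sum>m=1..Y. M\<^sup>2)"
      proof (rule sum_norm_le)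
        fix m assume m: "m \<in> {1..Y}"
        have "cmod (a (p * m)) \<le> M" using m pos[OF pq(1)] by (intro bound) simp
        then have "cmod (f p m) \<le> M" by (auto simp: f_def intro: order_trans[OF norm_ge_zero])
        then have "(cmod (f p m))\<^sup>2 \<le> M\<^sup>2" by (intro power_mono) auto
        then show "cmod (f p m * cnj (f q m)) \<le> M\<^sup>2"
          using True by (simp add: norm_mult power2_eq_square)
      qed
      then show ?thesis using True \<delta>(1) by (simp add: mult.commute add_increasing2)
    next
      case False
      then show ?thesis using corr[OF pq False] eq by simp
    qed
  qed
  have "complex_of_real (\<Sum>m=1..Y. (cmod (\<Sum>p\<in>S. f p m))\<^sup>2) = (\<Sum>m=1..Y. (\<Sum>p\<in>S. f p m) * cnj (\<Sum>q\<in>S. f q m))"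
    by (simp add: complex_norm_square del: of_real_power flip: of_real_power)
  also have "\<dots> = (\<Sum>m=1..Y. \<Sum>p\<in>S. \<Sum>q\<in>S. f p m * cnj (f q m))"
    by (simp only: cnj_sum sum_product)
  also have "\<dots> = (\<Sum>p\<in>S. \<Sum>q\<in>S. \<Sum>m=1..Y. f p m * cnj (f q m))"
    by (rule trans[OF sum.swap], rule sum.cong[OF refl], rule sum.swap)
  finally have "\<bar>\<Sum>m=1..Y. (cmod (\<Sum>p\<in>S. f p m))\<^sup>2\<bar> = cmod (\<Sum>p\<in>S. \<Sum>q\<in>S. \<Sum>m=1..Y. f p m * cnj (f q m))"
    by (simp only: flip: norm_of_real[where 'a = complex])
  then have "(\<Sum>m=1..Y. (cmod (\<Sum>p\<in>S. f p m))\<^sup>2) = cmod (\<Sum>p\<in>S. \<Sum>q\<in>S. \<Sum>m=1..Y. f p m * cnj (f q m))"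
    by (simp add: sum_nonneg)
  also have "\<dots> \<le> (\<Sum>p\<in>S. \<Sum>q\<in>S. (if p = q then M\<^sup>2 * real Y else 0) + \<delta> * real X)"
    by (intro sum_norm_le pair)
  also have "\<dots> = M\<^sup>2 * (real (card S) * real Y) + \<delta> * (real (card S))\<^sup>2 * real X"
    using fin by (simp add: sum.distrib power2_eq_square algebra_simps)
  also have "\<dots> \<le> M\<^sup>2 * real X + M\<^sup>2 * real X"
  proof (intro add_mono mult_left_mono mult_right_mono \<delta>(2))
    have "card S \<le> 2 ^ k" using card_mono[OF _ dyadic] by simp
    then have "card S * Y \<le> 2 ^ k * (X div 2 ^ k)" unfolding Y_def by (rule mult_le_mono1)
    also have "\<dots> \<le> X" by simp
    finally show "real (card S) * real Y \<le> real X" by (simp flip: of_nat_mult)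
  qed auto
  finally show ?thesis unfolding sum_f Y_def[symmetric] by linarith
qed

text \<open>
  When all \<open>p\<close> see the same set \<open>G\<close>, the second moment bound and the Cauchy--Schwarz inequality in
  \<open>m\<close> apply. The natural decay is \<open>sqrt (1/2) ^ k\<close>; the larger \<open>(3/4) ^ k\<close> avoids roots and is still
  summable over \<open>k\<close>.
\<close>

lemma common_set_bound:
  fixes a :: "nat \<Rightarrow> complex" and S :: "nat set"
  assumes dyadic: "S \<subseteq> {2 ^ k..<2 ^ (k + 1)}"
    and bound: "\<And>n. n \<ge> 1 \<Longrightarrow> cmod (a n) \<le> M"
    and corr: "\<And>p q. p \<in> S \<Longrightarrow> q \<in> S \<Longrightarrow> p \<noteq> q \<Longrightarrow>
      cmod (\<Sum>m=1..min (X div p) (X div q). a (p * m) * cnj (a (q * m))) \<le> \<delta> * real X"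
    and \<delta>: "\<delta> \<ge> 0" "\<delta> * (real (card S))\<^sup>2 \<le> M\<^sup>2"
  shows "cmod (\<Sum>p\<in>S. \<Sum>m=1..X div p. of_bool (G m) * a (p * m)) \<le> 2 * M * real X * (3/4) ^ k"
proof -
  define Y where "Y = X div 2 ^ k"
  define F where "F m = (\<Sum>p | p \<in> S \<and> m \<le> X div p. a (p * m))" for m
  have fin: "finite S" using dyadic finite_subset by blast
  have M: "M \<ge> 0" using bound[of 1] by (meson norm_ge_zero order_trans le_refl)
  have le: "X div p \<le> Y" if "p \<in> S" for p
    using dyadic that unfolding Y_def by (intro div_le_mono2) auto
  have "(\<Sum>p\<in>S. \<Sum>m=1..X div p. of_bool (G m) * a (p * m)) =
      (\<Sum>p\<in>S. \<Sum>m=1..Y. of_bool (m \<le> X div p) * (of_bool (G m) * a (p * m)))"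
    using le by (intro sum.cong refl sum.mono_neutral_cong_left) (auto dest: le)
  also have "\<dots> = (\<Sum>m=1..Y. \<Sum>p\<in>S. of_bool (m \<le> X div p) * (of_bool (G m) * a (p * m)))"
    by (rule sum.swap)
  also have "\<dots> = (\<Sum>m=1..Y. of_bool (G m) * F m)"
  proof (rule sum.cong[OF refl])
    fix m
    have "(\<Sum>p\<in>S. of_bool (m \<le> X div p) * (of_bool (G m) * a (p * m))) =
        (\<Sum>p | p \<in> S \<and> m \<le> X div p. of_bool (G m) * a (p * m))"
      using fin by (intro sum.mono_neutral_cong_right) auto
    then show "(\<Sum>p\<in>S. of_bool (m \<le> X div p) * (of_bool (G m) * a (p * m))) = of_bool (G m) * F m"
      by (simp add: F_def sum_distrib_left)
  qed
  finally have "cmod (\<Sum>p\<in>S. \<Sum>m=1..X div p. of_bool (G m) * a (p * m)) \<le> (\<Sum>m=1..Y. cmod (F m))"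
    by (simp only:) (rule sum_norm_le, simp add: norm_mult)
  also have "\<dots> \<le> 2 * M * real X * (3/4) ^ k"
  proof (rule power2_le_imp_le)
    have "(\<Sum>m=1..Y. cmod (F m))\<^sup>2 \<le> (\<Sum>m=1..Y. (cmod (F m))\<^sup>2) * real (card {1..Y})"
      by (rule sum_squared_le_sum_of_squares)
    also have "\<dots> \<le> (2 * M\<^sup>2 * real X) * real Y"
      using second_moment_nearly_orthogonal_dilates[OF assms] unfolding F_def Y_def
      by (simp add: mult_right_mono)
    also have "\<dots> \<le> (2 * M\<^sup>2 * real X) * (real X / 2 ^ k)"
      using of_nat_div_le_of_nat[of X "2 ^ k", where ?'a = real] unfolding Y_def
      by (intro mult_left_mono) auto
    also have "\<dots> = 2 * M\<^sup>2 * (real X)\<^sup>2 * (1/2) ^ k"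
      by (simp add: power2_eq_square power_divide)
    also have "\<dots> \<le> 4 * M\<^sup>2 * (real X)\<^sup>2 * (9/16) ^ k"
      using M by (intro mult_mono power_mono) auto
    also have "\<dots> = (2 * M * real X * (3/4) ^ k)\<^sup>2"
      by (simp add: power_mult_distrib power2_eq_square power_divide flip: power_mult_distrib)
    finally show "(\<Sum>m=1..Y. cmod (F m))\<^sup>2 \<le> (2 * M * real X * (3/4) ^ k)\<^sup>2" .
  qed (use M in auto)
  finally show ?thesis .
qed

text \<open>
  Here the sets \<open>\<Phi> p\<close> may depend on \<open>p\<close>. Replacing each by that of a representative of its colour
  costs at most \<open>\<epsilon> * M * (X / 2 ^ k)\<close> for each \<open>p\<close>, which is at most \<open>2 * \<epsilon> * M * X / p\<close>. After that,
  each of the \<open>C\<close> colour classes is covered by the previous bound. Restricting to a dyadic block makes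
  the range of \<open>m\<close> comparable for all \<open>p\<close>, so that one colouring, for \<open>y = X div 2 ^ k\<close>, is good for all
  of them.
\<close>

lemma dyadic_block_bound:
  fixes a :: "nat \<Rightarrow> complex" and R :: "nat set" and c :: "nat \<Rightarrow> nat"
  assumes dyadic: "R \<subseteq> {2 ^ k..<2 ^ (k + 1)}"
    and bound: "\<And>n. n \<ge> 1 \<Longrightarrow> cmod (a n) \<le> M"
    and corr: "\<And>p q. p \<in> R \<Longrightarrow> q \<in> R \<Longrightarrow> p \<noteq> q \<Longrightarrow>
      cmod (\<Sum>m=1..min (X div p) (X div q). a (p * m) * cnj (a (q * m))) \<le> \<delta> * real X"
    and \<delta>: "\<delta> \<ge> 0" "\<delta> * (real (card R))\<^sup>2 \<le> M\<^sup>2"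
    and c: "\<And>p. p \<in> R \<Longrightarrow> c p < C"
    and close: "\<And>p q. p \<in> R \<Longrightarrow> q \<in> R \<Longrightarrow> c p = c q \<Longrightarrow>
      real (card {m \<in> {1..X div 2 ^ k}. \<Phi> p m \<noteq> \<Phi> q m}) \<le> \<epsilon> * real (X div 2 ^ k)"
    and \<epsilon>: "\<epsilon> \<ge> 0"
  shows "cmod (\<Sum>p\<in>R. \<Sum>m=1..X div p. of_bool (\<Phi> p m) * a (p * m)) \<le>
    real C * (2 * M * real X * (3/4) ^ k) + 2 * \<epsilon> * M * real X * (\<Sum>p\<in>R. 1 / real p)"
proof -
  define Y where "Y = X div 2 ^ k"
  define T where "T p q = (\<Sum>m=1..X div p. of_bool (\<Phi> q m) * a (p * m))" for p q
  define rep where "rep j = (SOME q. q \<in> R \<and> c q = j)" for j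
  have rep: "rep (c p) \<in> R" "c (rep (c p)) = c p" if "p \<in> R" for p
    using someI[of "\<lambda>q. q \<in> R \<and> c q = c p" p] that unfolding rep_def by auto
  have fin: "finite R" using dyadic finite_subset by blast
  have M: "M \<ge> 0" using bound[of 1] by (meson norm_ge_zero order_trans le_refl)
  have error: "cmod (T p p - T p (rep (c p))) \<le> 2 * \<epsilon> * M * real X * (1 / real p)" if p: "p \<in> R" for p
  proof -
    define q where "q = rep (c p)"
    have p_bounds: "2 ^ k \<le> p" "p < 2 * 2 ^ k" "p > 0"
      using dyadic p by (auto intro: less_le_trans[of 0 "2 ^ k"])
    have "cmod (T p p - T p q) = cmod (\<Sum>m=1..X div p. (of_bool (\<Phi> p m) - of_bool (\<Phi> q m)) * a (p * m))"
      by (simp add: T_def sum_subtractf algebra_simps)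
    also have "\<dots> \<le> (\<Sum>m=1..X div p. if \<Phi> p m \<noteq> \<Phi> q m then M else 0)"
    proof (rule sum_norm_le)
      fix m assume "m \<in> {1..X div p}"
      then have "cmod (a (p * m)) \<le> M" using p_bounds by (intro bound) simp
      then show "cmod ((of_bool (\<Phi> p m) - of_bool (\<Phi> q m)) * a (p * m)) \<le> (if \<Phi> p m \<noteq> \<Phi> q m then M else 0)"
        by (cases "\<Phi> p m"; cases "\<Phi> q m") auto
    qed
    also have "\<dots> \<le> (\<Sum>m=1..Y. if \<Phi> p m \<noteq> \<Phi> q m then M else 0)"
      using M p_bounds unfolding Y_def
      by (intro sum_mono2) (auto intro: order_trans[OF _ div_le_mono2])
    also have "\<dots> = M * real (card {m \<in> {1..Y}. \<Phi> p m \<noteq> \<Phi> q m})"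
      by (simp add: sum.If_cases Int_def mult.commute)
    also have "\<dots> \<le> M * (\<epsilon> * real Y)"
      using close[OF p rep(1)[OF p]] rep(2)[OF p] M unfolding Y_def q_def
      by (intro mult_left_mono) auto
    also have "\<dots> \<le> M * (\<epsilon> * (real X / 2 ^ k))"
      using of_nat_div_le_of_nat[of X "2 ^ k", where ?'a = real] M \<epsilon> unfolding Y_def
      by (intro mult_left_mono) auto
    also have "\<dots> \<le> M * (\<epsilon> * (real X * (2 * (1 / real p))))"
    proof -
      have "real p \<le> 2 * 2 ^ k"
        using of_nat_mono[OF less_imp_le[OF p_bounds(2)], where 'a = real] by simp
      then have "1 / 2 ^ k \<le> 2 * (1 / real p)"
        using p_bounds by (simp add: field_simps)
      then have "real X * (1 / 2 ^ k) \<le> real X * (2 * (1 / real p))" by (rule mult_left_mono) simp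
      then show ?thesis using M \<epsilon> by (intro mult_left_mono) auto
    qed
    finally show ?thesis by (simp add: q_def mult_ac)
  qed
  have "(\<Sum>p\<in>R. T p (rep (c p))) = (\<Sum>j<C. \<Sum>p | p \<in> R \<and> c p = j. T p (rep (c p)))"
    using fin c by (intro sum.group[symmetric]) auto
  also have "cmod \<dots> \<le> (\<Sum>j<C. 2 * M * real X * (3/4) ^ k)"
  proof (rule sum_norm_le)
    fix j
    have "(real (card {p \<in> R. c p = j}))\<^sup>2 \<le> (real (card R))\<^sup>2"
      using fin by (intro power_mono) (auto intro: card_mono)
    then have "\<delta> * (real (card {p \<in> R. c p = j}))\<^sup>2 \<le> M\<^sup>2"
      using \<delta> by (meson mult_left_mono order_trans)
    then have "cmod (\<Sum>p\<in>{p \<in> R. c p = j}. \<Sum>m=1..X div p. of_bool (\<Phi> (rep j) m) * a (p * m)) \<le>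
        2 * M * real X * (3/4) ^ k"
      using dyadic by (intro common_set_bound[where \<delta> = \<delta>] bound corr \<delta>(1)) auto
    then show "cmod (\<Sum>p | p \<in> R \<and> c p = j. T p (rep (c p))) \<le> 2 * M * real X * (3/4) ^ k"
      by (simp add: T_def)
  qed
  finally have main: "cmod (\<Sum>p\<in>R. T p (rep (c p))) \<le> real C * (2 * M * real X * (3/4) ^ k)"
    by simp
  have "(\<Sum>p\<in>R. T p p) = (\<Sum>p\<in>R. T p (rep (c p))) + (\<Sum>p\<in>R. T p p - T p (rep (c p)))"
    by (simp add: sum_subtractf)
  also have "cmod \<dots> \<le> cmod (\<Sum>p\<in>R. T p (rep (c p))) + cmod (\<Sum>p\<in>R. T p p - T p (rep (c p)))"
    by (rule norm_triangle_ineq)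
  also have "\<dots> \<le> real C * (2 * M * real X * (3/4) ^ k) + (\<Sum>p\<in>R. 2 * \<epsilon> * M * real X * (1 / real p))"
    by (intro add_mono main sum_norm_le error)
  also have "(\<Sum>p\<in>R. 2 * \<epsilon> * M * real X * (1 / real p)) = 2 * \<epsilon> * M * real X * (\<Sum>p\<in>R. 1 / real p)"
    by (simp only: sum_distrib_left)
  finally show ?thesis by (simp add: T_def)
qed

text \<open>
  Summing over the dyadic blocks, the contribution of the \<open>C\<close> colours stays bounded because of the
  factor \<open>(3/4) ^ k\<close>, while the approximation error is proportional to \<open>\<epsilon>\<close> times the sum of \<open>1 / p\<close>.
\<close>

lemma dilates_bound:
  fixes a :: "nat \<Rightarrow> complex" and Q :: "nat set"
  assumes fin: "finite Q" and primes: "\<And>p. p \<in> Q \<Longrightarrow> prime p"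
    and bound: "\<And>n. n \<ge> 1 \<Longrightarrow> cmod (a n) \<le> M"
    and corr: "\<And>p q. p \<in> Q \<Longrightarrow> q \<in> Q \<Longrightarrow> p \<noteq> q \<Longrightarrow>
      cmod (\<Sum>m=1..min (X div p) (X div q). a (p * m) * cnj (a (q * m))) \<le> \<delta> * real X"
    and \<delta>: "\<delta> \<ge> 0" "\<delta> * (real (card Q))\<^sup>2 \<le> M\<^sup>2"
    and classes: "\<And>y. \<exists>c::nat \<Rightarrow> nat. (\<forall>p\<in>Q. c p < C) \<and> (\<forall>p\<in>Q. \<forall>q\<in>Q. c p = c q \<longrightarrow>
      real (card {m \<in> {1..y}. \<Phi> p m \<noteq> \<Phi> q m}) \<le> \<epsilon> * real y)"
    and \<epsilon>: "\<epsilon> \<ge> 0"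
  shows "cmod (\<Sum>p\<in>Q. \<Sum>m=1..X div p. of_bool (\<Phi> p m) * a (p * m)) \<le>
    8 * real C * M * real X + 2 * \<epsilon> * M * real X * (\<Sum>p\<in>Q. 1 / real p)"
proof -
  have M: "M \<ge> 0" using bound[of 1] by (meson norm_ge_zero order_trans le_refl)
  have "\<exists>k. 2 ^ k \<le> p \<and> p < 2 ^ (k + 1)" if "p > 0" for p :: nat
    using ex_power_ivl1[of 2 p] that by auto
  then obtain \<kappa> where \<kappa>: "\<And>p::nat. p > 0 \<Longrightarrow> 2 ^ \<kappa> p \<le> p \<and> p < 2 ^ (\<kappa> p + 1)" by metis
  define R where "R k = {p \<in> Q. \<kappa> p = k}" for k
  have block: "cmod (\<Sum>p\<in>R k. \<Sum>m=1..X div p. of_bool (\<Phi> p m) * a (p * m)) \<le>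
      real C * (2 * M * real X * (3/4) ^ k) + 2 * \<epsilon> * M * real X * (\<Sum>p\<in>R k. 1 / real p)" for k
  proof -
    obtain c :: "nat \<Rightarrow> nat" where c: "\<forall>p\<in>Q. c p < C" "\<forall>p\<in>Q. \<forall>q\<in>Q. c p = c q \<longrightarrow>
      real (card {m \<in> {1..X div 2 ^ k}. \<Phi> p m \<noteq> \<Phi> q m}) \<le> \<epsilon> * real (X div 2 ^ k)"
      using classes[of "X div 2 ^ k"] by blast
    have "R k \<subseteq> {2 ^ k..<2 ^ (k + 1)}"
      using \<kappa>[OF prime_gt_0_nat[OF primes]] by (auto simp: R_def)
    moreover have "(real (card (R k)))\<^sup>2 \<le> (real (card Q))\<^sup>2"
      using fin unfolding R_def by (intro power_mono) (auto intro: card_mono)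
    then have "\<delta> * (real (card (R k)))\<^sup>2 \<le> M\<^sup>2"
      using \<delta> by (meson mult_left_mono order_trans)
    ultimately show ?thesis
      using c by (intro dyadic_block_bound[where \<delta> = \<delta> and c = c] bound corr \<delta>(1) \<epsilon>) (auto simp: R_def)
  qed
  have group: "(\<Sum>p\<in>Q. g p) = (\<Sum>k\<in>\<kappa> ` Q. \<Sum>p\<in>R k. g p)" for g :: "nat \<Rightarrow> 'x::comm_monoid_add"
    unfolding R_def using fin by (intro sum.group[symmetric]) auto
  have "cmod (\<Sum>p\<in>Q. \<Sum>m=1..X div p. of_bool (\<Phi> p m) * a (p * m)) \<le>
      (\<Sum>k\<in>\<kappa> ` Q. real C * (2 * M * real X * (3/4) ^ k) + 2 * \<epsilon> * M * real X * (\<Sum>p\<in>R k. 1 / real p))"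
    unfolding group by (intro sum_norm_le block)
  also have "\<dots> = real C * (2 * M * real X) * (\<Sum>k\<in>\<kappa> ` Q. (3/4) ^ k) + 2 * \<epsilon> * M * real X * (\<Sum>p\<in>Q. 1 / real p)"
    by (simp add: sum.distrib sum_distrib_left group[of "\<lambda>p. 1 / real p"] mult.assoc)
  also have "\<dots> \<le> real C * (2 * M * real X) * 4 + 2 * \<epsilon> * M * real X * (\<Sum>p\<in>Q. 1 / real p)"
  proof -
    have "(\<Sum>k\<in>\<kappa> ` Q. (3/4) ^ k) \<le> (\<Sum>k. (3/4::real) ^ k)"
      using fin by (intro sum_le_suminf) (auto intro: summable_geometric)
    also have "\<dots> = 4" by (subst suminf_geometric) auto
    finally show ?thesis using M by (intro add_right_mono mult_left_mono) auto
  qed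
  finally show ?thesis by (simp add: mult_ac)
qed

section \<open>The orthogonality criterion\<close>

lemma eventually_correlation_min:
  fixes a :: "nat \<Rightarrow> complex"
  assumes "p > 0" "q > 0" "\<delta> > 0"
    and "\<And>\<delta>. \<delta> > 0 \<Longrightarrow> \<forall>\<^sub>F X in sequentially. cmod (\<Sum>m=1..X. a (p * m) * cnj (a (q * m))) \<le> \<delta> * real X"
  shows "\<forall>\<^sub>F X in sequentially.
    cmod (\<Sum>m=1..min (X div p) (X div q). a (p * m) * cnj (a (q * m))) \<le> \<delta> * real X"
proof -
  have "filterlim (\<lambda>X. min (X div p) (X div q)) at_top sequentially"
    unfolding filterlim_at_top
  proof
    fix Z :: nat
    have "Z \<le> min (X div p) (X div q)" if "X \<ge> max (Z * p) (Z * q)" for X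
      using that assms(1,2) by (simp add: less_eq_div_iff_mult_less_eq)
    then show "\<forall>\<^sub>F X in sequentially. Z \<le> min (X div p) (X div q)"
      unfolding eventually_sequentially by blast
  qed
  from filterlim_iff[THEN iffD1, OF this, rule_format, OF assms(4)[OF assms(3)]]
  show ?thesis
  proof eventually_elim
    case (elim X)
    have "min (X div p) (X div q) \<le> X" by (simp add: min.coboundedI1)
    then have "\<delta> * real (min (X div p) (X div q)) \<le> \<delta> * real X"
      using assms(3) by (intro mult_left_mono) auto
    with elim show ?case by linarith
  qed
qed

text \<open>
  With \<open>A\<close> the sum of \<open>1 / p\<close> over \<open>Q\<close>, the preceding bounds add up to
  \<open>M * X * (8 * C + 2 + 2 * \<epsilon> * A + sqrt (2 * A))\<close> for \<open>A\<close> times the sum in question. Since \<open>C\<close> depends on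
  \<open>\<epsilon>\<close> but not on \<open>Q\<close>, one may fix \<open>\<epsilon>\<close> first and then, by divergence, take \<open>A\<close> as large as required;
  only then does \<open>X\<close> tend to infinity, so that the finitely many correlations of dilates by primes in
  \<open>Q\<close> become negligible.

  If \<open>\<Phi> p m\<close> does not depend on \<open>p\<close> at all, one colour suffices and this is the classical method of
  Daboussi and Katai.
\<close>

theorem orthogonality_criterion:
  fixes a :: "nat \<Rightarrow> complex" and E P :: "nat set"
  assumes bound: "\<And>n. n \<ge> 1 \<Longrightarrow> cmod (a n) \<le> M" and M: "M > 0"
    and corr: "\<And>p q \<delta>. prime p \<Longrightarrow> prime q \<Longrightarrow> p \<noteq> q \<Longrightarrow> \<delta> > 0 \<Longrightarrow>
      \<forall>\<^sub>F X in sequentially. cmod (\<Sum>m=1..X. a (p * m) * cnj (a (q * m))) \<le> \<delta> * real X"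
    and primes: "\<And>p. p \<in> P \<Longrightarrow> prime p"
    and diverges: "\<not> (\<lambda>p. 1 / real p) summable_on P"
    and E: "\<And>p m. p \<in> P \<Longrightarrow> m > 0 \<Longrightarrow> coprime p m \<Longrightarrow> p * m \<in> E \<longleftrightarrow> \<Phi> p m"
    and \<Phi>: "uniformly_totally_bounded P \<Phi>"
    and \<eta>: "\<eta> > 0"
  shows "\<forall>\<^sub>F X in sequentially. cmod (\<Sum>n=1..X. indicator E n * a n) \<le> \<eta> * real X"
proof -
  \<comment> \<open>Allows the approximation error \<open>2 * \<epsilon> * M\<close> to be \<open>\<eta> / 4\<close>.\<close>
  define \<epsilon> where "\<epsilon> = \<eta> / (8 * M)"
  have \<epsilon>: "\<epsilon> > 0" using \<eta> M by (simp add: \<epsilon>_def)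
  obtain C where C: "\<And>y. \<exists>c::nat \<Rightarrow> nat. (\<forall>p\<in>P. c p < C) \<and> (\<forall>p\<in>P. \<forall>q\<in>P. c p = c q \<longrightarrow>
      real (card {m \<in> {1..y}. \<Phi> p m \<noteq> \<Phi> q m}) \<le> \<epsilon> * real y)"
    using \<Phi> \<epsilon> unfolding uniformly_totally_bounded_def by blast
  \<comment> \<open>The first entry makes the variance term, the second the bounded terms, at most \<open>\<eta> / 4\<close> after division by \<open>A * X\<close>.\<close>
  define B where "B = max (32 * M\<^sup>2 / \<eta>\<^sup>2) (4 * (2 * M + 8 * real C * M) / \<eta>)"
  obtain Q where Q: "finite Q" "Q \<subseteq> P" "(\<Sum>p\<in>Q. 1 / real p) > B"
  proof -
    have "\<not> (\<forall>F. finite F \<longrightarrow> F \<subseteq> P \<longrightarrow> (\<Sum>p\<in>F. 1 / real p) \<le> B)"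
      using diverges nonneg_bounded_partial_sums_imp_summable_on[of P "\<lambda>p. 1 / real p" B]
      by (auto intro!: eventually_finite_subsets_at_top_weakI)
    then show ?thesis using that by (auto simp: not_le)
  qed
  define A where "A = (\<Sum>p\<in>Q. 1 / real p)"
  have A: "A > 0" "32 * M\<^sup>2 / \<eta>\<^sup>2 \<le> A" "4 * (2 * M + 8 * real C * M) / \<eta> \<le> A"
  proof -
    have "0 < 32 * M\<^sup>2 / \<eta>\<^sup>2" using M \<eta> by simp
    with Q(3) show "A > 0" "32 * M\<^sup>2 / \<eta>\<^sup>2 \<le> A" "4 * (2 * M + 8 * real C * M) / \<eta> \<le> A"
      unfolding A_def[symmetric] B_def by linarith+
  qed
  have prime_Q: "prime p" if "p \<in> Q" for p using that Q(2) primes by blast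
  \<comment> \<open>The off-diagonal correlations, fewer than the square of \<open>card Q\<close> many, then add up to at most \<open>M\<^sup>2 * X\<close>; adding \<open>1\<close> keeps the denominator positive.\<close>
  define \<delta> where "\<delta> = M\<^sup>2 / ((real (card Q))\<^sup>2 + 1)"
  have den: "(real (card Q))\<^sup>2 + 1 > 0" by (intro add_nonneg_pos) auto
  have \<delta>: "\<delta> > 0" "\<delta> * (real (card Q))\<^sup>2 \<le> M\<^sup>2"
    using M den by (auto simp: \<delta>_def field_simps)
  have "\<forall>\<^sub>F X in sequentially. \<forall>p\<in>Q. \<forall>q\<in>Q. p \<noteq> q \<longrightarrow>
      cmod (\<Sum>m=1..min (X div p) (X div q). a (p * m) * cnj (a (q * m))) \<le> \<delta> * real X"
  proof (intro eventually_ball_finite ballI Q(1))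
    fix p q assume "p \<in> Q" "q \<in> Q"
    then have "prime p" "prime q" using prime_Q by auto
    then show "\<forall>\<^sub>F X in sequentially. p \<noteq> q \<longrightarrow>
      cmod (\<Sum>m=1..min (X div p) (X div q). a (p * m) * cnj (a (q * m))) \<le> \<delta> * real X"
    proof (cases "p = q")
      case False
      with eventually_correlation_min[OF prime_gt_0_nat[OF \<open>prime p\<close>] prime_gt_0_nat[OF \<open>prime q\<close>]
          \<delta>(1) corr[OF \<open>prime p\<close> \<open>prime q\<close>]]
      show ?thesis by (simp only: not_False_eq_True simp_thms)
    qed simp
  qed
  moreover have "\<forall>\<^sub>F X in sequentially. 2 * card Q \<le> X" by (rule eventually_ge_at_top)
  ultimately show ?thesis
  proof eventually_elim
    case (elim X)
    have classes: "\<exists>c::nat \<Rightarrow> nat. (\<forall>p\<in>Q. c p < C) \<and> (\<forall>p\<in>Q. \<forall>q\<in>Q. c p = c q \<longrightarrow>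
      real (card {m \<in> {1..y}. \<Phi> p m \<noteq> \<Phi> q m}) \<le> \<epsilon> * real y)" for y
      using C[of y] Q(2) by (meson subsetD)
    have ind: "cmod (indicator E n * a n) \<le> M" if "n \<ge> 1" for n
      using bound[OF that] M by (simp add: indicator_def)
    have "A * cmod (\<Sum>n=1..X. indicator E n * a n) \<le>
        cmod (\<Sum>p\<in>Q. \<Sum>m=1..X div p. indicator E (p * m) * a (p * m)) + M * (real X * sqrt (2 * A))"
      unfolding A_def by (intro Turan_Kubilius_weighted Q(1) prime_Q ind elim(2))
    also have "cmod (\<Sum>p\<in>Q. \<Sum>m=1..X div p. indicator E (p * m) * a (p * m)) \<le>
        cmod (\<Sum>p\<in>Q. \<Sum>m=1..X div p. of_bool (\<Phi> p m) * a (p * m)) + 2 * M * real X"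
      using E Q(2) by (intro coprimality_defect Q(1) prime_Q bound) auto
    also have "cmod (\<Sum>p\<in>Q. \<Sum>m=1..X div p. of_bool (\<Phi> p m) * a (p * m)) \<le>
        8 * real C * M * real X + 2 * \<epsilon> * M * real X * A"
      unfolding A_def using elim(1) \<delta> \<epsilon>
      by (intro dilates_bound[where \<delta> = \<delta>] Q(1) prime_Q bound classes) auto
    finally have *: "A * cmod (\<Sum>n=1..X. indicator E n * a n) \<le>
        real X * (8 * real C * M + 2 * M + 2 * \<epsilon> * M * A + M * sqrt (2 * A))"
      by (simp add: algebra_simps)
    have "8 * real C * M + 2 * M \<le> \<eta> * A / 4"
      using A(3) \<eta> by (simp add: field_simps)
    moreover have "2 * \<epsilon> * M * A = \<eta> * A / 4"
      using M by (simp add: \<epsilon>_def)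
    moreover have "M * sqrt (2 * A) \<le> \<eta> * A / 4"
    proof (rule power2_le_imp_le)
      have "32 * M\<^sup>2 \<le> A * \<eta>\<^sup>2" using A(2) \<eta> by (simp add: field_simps)
      from mult_right_mono[OF this, of A]
      show "(M * sqrt (2 * A))\<^sup>2 \<le> (\<eta> * A / 4)\<^sup>2"
        using A(1) by (simp add: power_mult_distrib power_divide power2_eq_square mult_ac)
    qed (use A(1) \<eta> in simp)
    ultimately have "8 * real C * M + 2 * M + 2 * \<epsilon> * M * A + M * sqrt (2 * A) \<le> \<eta> * A"
      using A(1) \<eta> mult_pos_pos[OF \<eta> A(1)] by linarith
    then have "real X * (8 * real C * M + 2 * M + 2 * \<epsilon> * M * A + M * sqrt (2 * A)) \<le> real X * (\<eta> * A)"
      by (rule mult_left_mono) simp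
    with * have "A * cmod (\<Sum>n=1..X. indicator E n * a n) \<le> A * (\<eta> * real X)" by (simp add: mult_ac)
    then show ?case using A(1) by simp
  qed
qed

section \<open>Sets defined by multiplicative functions\<close>

lemma smallo_floor_iff:
  fixes f :: "nat \<Rightarrow> complex"
  shows "(\<lambda>x::real. f (nat \<lfloor>x\<rfloor>)) \<in> o[at_top](\<lambda>x. of_real x) \<longleftrightarrow>
    (\<forall>c>0. \<forall>\<^sub>F X in sequentially. cmod (f X) \<le> c * real X)"
proof
  assume o: "(\<lambda>x::real. f (nat \<lfloor>x\<rfloor>)) \<in> o[at_top](\<lambda>x. of_real x)"
  show "\<forall>c>0. \<forall>\<^sub>F X in sequentially. cmod (f X) \<le> c * real X"
  proof (intro allI impI)
    fix c :: real assume "c > 0"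
    from landau_o.smallD[OF o this]
    have "\<forall>\<^sub>F x::real in at_top. cmod (f (nat \<lfloor>x\<rfloor>)) \<le> c * \<bar>x\<bar>" by simp
    from eventually_compose_filterlim[OF this filterlim_real_sequentially]
    show "\<forall>\<^sub>F X in sequentially. cmod (f X) \<le> c * real X" by simp
  qed
next
  assume *: "\<forall>c>0. \<forall>\<^sub>F X in sequentially. cmod (f X) \<le> c * real X"
  show "(\<lambda>x::real. f (nat \<lfloor>x\<rfloor>)) \<in> o[at_top](\<lambda>x. of_real x)"
  proof (rule landau_o.smallI)
    fix c :: real assume c: "c > 0"
    have "filterlim (\<lambda>x::real. nat \<lfloor>x\<rfloor>) sequentially at_top"
      by (intro filterlim_compose[OF filterlim_nat_sequentially filterlim_floor_sequentially])
    from eventually_compose_filterlim[OF *[rule_format, OF c] this] eventually_ge_at_top[of 0]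
    show "\<forall>\<^sub>F x::real in at_top. cmod (f (nat \<lfloor>x\<rfloor>)) \<le> c * cmod (of_real x)"
    proof eventually_elim
      case (elim x)
      have "c * real (nat \<lfloor>x\<rfloor>) \<le> c * x" using c elim(2) by (intro mult_left_mono) auto
      then show ?case using elim by simp
    qed
  qed
qed

theorem theorem1:
  fixes a :: "nat \<Rightarrow> complex" and E :: "nat set"
  assumes "bounded (a ` {1..})"
    and "\<And>p q :: nat. prime p \<Longrightarrow> prime q \<Longrightarrow> p \<noteq> q \<Longrightarrow>
           (\<lambda>x::real. \<Sum>n=1..nat \<lfloor>x\<rfloor>. a (p * n) * cnj (a (q * n))) \<in> o[at_top](\<lambda>x. of_real x)"
    and "E \<in> D_inf \<union> E_cpt \<union> E_pol"
  shows "(\<lambda>x::real. \<Sum>n=1..nat \<lfloor>x\<rfloor>. indicator E n * a n) \<in> o[at_top](\<lambda>x. of_real x)"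
proof -
  obtain M where M: "M > 0" "\<And>n. n \<ge> 1 \<Longrightarrow> cmod (a n) \<le> M"
    using assms(1) unfolding bounded_pos by auto
  have corr: "\<forall>\<^sub>F X in sequentially. cmod (\<Sum>m=1..X. a (p * m) * cnj (a (q * m))) \<le> \<delta> * real X"
    if "prime p" "prime q" "p \<noteq> q" "\<delta> > 0" for p q :: nat and \<delta>
    using assms(2)[OF that(1-3)] that(4) smallo_floor_iff[of "\<lambda>X. \<Sum>m=1..X. a (p * m) * cnj (a (q * m))"]
    by blast
  have mult: "f (p * m) = f p * f m" if "multiplicative_fun f" "prime p" "m > 0" "coprime p m" for f and p m :: nat
    using that prime_gt_0_nat unfolding multiplicative_fun_def by blast
  obtain P \<Phi> where P: "\<And>p. p \<in> P \<Longrightarrow> prime p" "\<not> (\<lambda>p. 1 / real p) summable_on P"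
    "\<And>p m. p \<in> P \<Longrightarrow> m > 0 \<Longrightarrow> coprime p m \<Longrightarrow> p * m \<in> E \<longleftrightarrow> \<Phi> p m"
    "uniformly_totally_bounded P \<Phi>"
  proof -
    consider "E \<in> D_inf" | "E \<in> E_cpt" | "E \<in> E_pol" using assms(3) by blast
    then show ?thesis
    proof cases
      case 1
      then obtain r f z where E: "E = {n. n > 0 \<and> (\<forall>i\<in>{1..r}. f i n = z i)}"
        and f: "\<forall>i\<in>{1..r::nat}. multiplicative_fun (f i)"
        unfolding D_inf_def D_class_def by blast
      have "uniformly_totally_bounded {p. prime p} (\<lambda>p m. \<forall>i\<in>{1..r}. f i p * f i m \<in> {z i})"
        by (intro uniformly_totally_bounded_Ball uniformly_totally_bounded_elementary_polar
            elementary_polar_singleton) simp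
      moreover have "p * m \<in> E \<longleftrightarrow> (\<forall>i\<in>{1..r}. f i p * f i m \<in> {z i})"
        if "prime p" "m > 0" "coprime p m" for p m
        using mult[OF _ that] f that prime_gt_0_nat[of p] by (simp add: E)
      ultimately show ?thesis
        using not_summable_prime_reciprocals by (intro that[of "{p. prime p}"]) auto
    next
      case 2
      then obtain f K z where E: "E = {n. n > 0 \<and> f n \<in> K}" and f: "multiplicative_fun f"
        and z: "concentration_point f z"
        unfolding E_cpt_def by blast
      show ?thesis
      proof (rule that)
        show "\<not> (\<lambda>p. 1 / real p) summable_on {p. prime p \<and> f p = z}"
          using z unfolding concentration_point_def .
        \<comment> \<open>On these primes \<open>f p\<close> is constant, so that the dilates of \<open>E\<close> coincide, whatever \<open>K\<close> is.\<close>
        show "uniformly_totally_bounded {p. prime p \<and> f p = z} (\<lambda>p m. z * f m \<in> K)"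
          by (rule uniformly_totally_bounded_fixed_set)
        show "p * m \<in> E \<longleftrightarrow> z * f m \<in> K" if "p \<in> {p. prime p \<and> f p = z}" "m > 0" "coprime p m" for p m
          using mult[OF f _ that(2,3)] that prime_gt_0_nat[of p] by (simp add: E)
      qed simp
    next
      case 3
      then obtain f K where E: "E = {n. n > 0 \<and> f n \<in> K}" and f: "multiplicative_fun f"
        and K: "elementary_polar K"
        unfolding E_pol_def by blast
      show ?thesis
      proof (rule that)
        show "\<not> (\<lambda>p. 1 / real p) summable_on {p::nat. prime p}"
          by (rule not_summable_prime_reciprocals)
        show "uniformly_totally_bounded {p. prime p} (\<lambda>p m. f p * f m \<in> K)"
          by (rule uniformly_totally_bounded_elementary_polar[OF K])
        show "p * m \<in> E \<longleftrightarrow> f p * f m \<in> K" if "p \<in> {p. prime p}" "m > 0" "coprime p m" for p m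
          using mult[OF f _ that(2,3)] that prime_gt_0_nat[of p] by (simp add: E)
      qed simp
    qed
  qed
  show ?thesis
    unfolding smallo_floor_iff[of "\<lambda>X. \<Sum>n=1..X. indicator E n * a n"]
    by (intro allI impI orthogonality_criterion[OF M(2,1) corr P])
qed

end
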